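(* Let $(X,\mathcal{B}_X,\mu,T)$ be a $\mathbb{Z}^2$-measure preserving dynamical system and let $\vec{v}=(1,\beta)$ with $\beta\in\mathbb{R}$ irrational. For any $b\in(0,\infty)$, the following statements are equivalent. (a) $(X,\mathcal{B}_X,\mu,T)$ is $\vec{v}$-weakly mixing. (b) For any $f\in L^2(X,\mathcal{B}_X,\mu)$, $$\lim_{k\to\infty}\frac{1}{\#(\Lambda_k^{\vec{v}}(b))}\sum_{(m,n)\in\Lambda_k^{\vec{v}}(b)}\left|\langle U_T^{(m,n)}f,f\rangle-\langle f,1\rangle\langle 1,f\rangle\right|=0.$$ (c) For any $f,g\in L^2(X,\mathcal{B}_X,\mu)$, $$\lim_{k\to\infty}\frac{1}{\#(\Lambda_k^{\vec{v}}(b))}\sum_{(m,n)\in\Lambda_k^{\vec{v}}(b)}\left|\langle U_T^{(m,n)}f,g\rangle-\langle f,1\rangle\langle 1,g\rangle\right|=0.$$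
   Context: A $\mathbb{Z}^2$-measure preserving dynamical system $(X,\mathcal{B}_X,\mu,T)$ consists of a compact metric space $X$, its Borel $\sigma$-algebra $\mathcal{B}_X$, a group homomorphism $(m,n)\mapsto T^{(m,n)}$ from the additive group $\mathbb{Z}^2$ to the group of homeomorphisms of $X$, and a Borel probability measure $\mu$ invariant under every $T^{(m,n)}$. For $f\in L^2(X,\mathcal{B}_X,\mu)$ (complex-valued), $U_T^{(m,n)}f=f\circ T^{(m,n)}$, and $\langle f,g\rangle=\int_X f\overline{g}\,d\mu$; $1$ denotes the constant function, and $1_B$ the indicator function of $B$. For $\vec{v}=(1,\beta)$ and $b\in(0,\infty)$, $\Lambda^{\vec{v}}(b)=\{(m,n)\in\mathbb{Z}^2:\beta m-b\le n\le\beta m+b\}$, and for $k\in\mathbb{N}$, $\Lambda_k^{\vec{v}}(b)=\Lambda^{\vec{v}}(b)\cap([0,k-1]\times\mathbb{Z})$. $\#$ denotes cardinality. The directional Kronecker algebra $\mathcal{K}_\mu^{\vec{v}}$ is the $\sigma$-algebra of all $B\in\mathcal{B}_X$ such that the closure of $\{U_T^{(m,n)}1_B:(m,n)\in\Lambda^{\vec{v}}(b)\}$ is compact in $L^2(X,\mathcal{B}_X,\mu)$; it does not depend on the choice of $b\in(0,\infty)$. The system is called $\vec{v}$-weakly mixing if $\mathcal{K}_\mu^{\vec{v}}$ is trivial, i.e. $\mathcal{K}_\mu^{\vec{v}}=\{X,\emptyset\}$ modulo $\mu$-null sets (every $B\in\mathcal{K}_\mu^{\vec{v}}$ has $\mu(B)\in\{0,1\}$).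 *)

theory Defs
  imports "HOL-Probability.Probability"
begin

section \<open>\<open>\<int>\<^sup>2\<close>-measure preserving dynamical systems\<close>

text \<open>
  The compact metric space is the whole (compact) type \<open>'a\<close>; the action is a homomorphism from the
  additive group \<open>int \<times> int\<close> to the homeomorphisms of \<open>'a\<close>, so \<open>T 0 = id\<close> and
  \<open>T (- v) = inv (T v)\<close> are consequences.
\<close>

locale Z2_mpds = prob_space M
  for M :: "'a::metric_space measure" and T :: "int \<times> int \<Rightarrow> 'a \<Rightarrow> 'a" +
  assumes compact_space: "compact (UNIV :: 'a set)"
    and sets_eq_borel: "sets M = sets borel"
    and homeomorphism_T: "\<And>v. \<exists>g. homeomorphism UNIV UNIV (T v) g"
    and T_add: "\<And>v w. T (v + w) = T v \<circ> T w"
    and T_invariant: "\<And>v. distr M M (T v) = M"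


section \<open>The space \<open>L\<^sup>2\<close>\<close>

definition L2_fun :: "'a measure \<Rightarrow> ('a \<Rightarrow> complex) set" where
  "L2_fun M = {f \<in> borel_measurable M. integrable M (\<lambda>x. (cmod (f x))\<^sup>2)}"

definition L2_norm :: "'a measure \<Rightarrow> ('a \<Rightarrow> complex) \<Rightarrow> real" where
  "L2_norm M f = sqrt (\<integral>x. (cmod (f x))\<^sup>2 \<partial>M)"

definition L2_inner :: "'a measure \<Rightarrow> ('a \<Rightarrow> complex) \<Rightarrow> ('a \<Rightarrow> complex) \<Rightarrow> complex" where
  "L2_inner M f g = (\<integral>x. f x * cnj (g x) \<partial>M)"

text \<open>
  Elements of \<open>L\<^sup>2\<close> are classes of square integrable functions modulo equality almost everywhere.
  The distance picks representatives; it does not depend on them, see \<open>L2_dist_class\<close> below.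
\<close>

definition L2_class :: "'a measure \<Rightarrow> ('a \<Rightarrow> complex) \<Rightarrow> ('a \<Rightarrow> complex) set" where
  "L2_class M f = {g \<in> L2_fun M. AE x in M. g x = f x}"

definition L2_space :: "'a measure \<Rightarrow> ('a \<Rightarrow> complex) set set" where
  "L2_space M = L2_class M ` L2_fun M"

definition L2_dist :: "'a measure \<Rightarrow> ('a \<Rightarrow> complex) set \<Rightarrow> ('a \<Rightarrow> complex) set \<Rightarrow> real" where
  "L2_dist M F G = L2_norm M (\<lambda>x. (SOME f. f \<in> F) x - (SOME g. g \<in> G) x)"

definition L2_topology :: "'a measure \<Rightarrow> ('a \<Rightarrow> complex) set topology" where
  "L2_topology M = Metric_space.mtopology (L2_space M) (L2_dist M)"

definition koopman :: "(int \<times> int \<Rightarrow> 'a \<Rightarrow> 'a) \<Rightarrow> int \<times> int \<Rightarrow> ('a \<Rightarrow> complex) \<Rightarrow> 'a \<Rightarrow> complex" where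
  "koopman T v f = f \<circ> T v"


section \<open>Directional notions for the direction \<open>(1, \<beta>)\<close>\<close>

definition strip :: "real \<Rightarrow> real \<Rightarrow> (int \<times> int) set" where
  "strip \<beta> b = {(m, n). \<beta> * of_int m - b \<le> of_int n \<and> of_int n \<le> \<beta> * of_int m + b}"

definition strip_upto :: "real \<Rightarrow> real \<Rightarrow> nat \<Rightarrow> (int \<times> int) set" where
  "strip_upto \<beta> b k = strip \<beta> b \<inter> ({0..int k - 1} \<times> UNIV)"

text \<open>
  The condition does not depend on the width \<open>b > 0\<close> of the strip, so quantifying over all widths is
  the same as fixing any one of them; see \<open>directional_kronecker_eq\<close> below.
\<close>

definition directional_kronecker ::
  "'a measure \<Rightarrow> (int \<times> int \<Rightarrow> 'a \<Rightarrow> 'a) \<Rightarrow> real \<Rightarrow> 'a set set" where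
  "directional_kronecker M T \<beta> = {B \<in> sets M. \<forall>b>0.
     compactin (L2_topology M)
       (L2_topology M closure_of ((\<lambda>v. L2_class M (koopman T v (indicator B))) ` strip \<beta> b))}"

definition directional_weakly_mixing ::
  "'a measure \<Rightarrow> (int \<times> int \<Rightarrow> 'a \<Rightarrow> 'a) \<Rightarrow> real \<Rightarrow> bool" where
  "directional_weakly_mixing M T \<beta> \<longleftrightarrow>
     (\<forall>B \<in> directional_kronecker M T \<beta>. measure M B \<in> {0, 1})"


section \<open>The \<open>L\<^sup>2\<close> distance is a metric\<close>

lemma L2_funD:
  assumes "f \<in> L2_fun M"
  shows "f \<in> borel_measurable M" "integrable M (\<lambda>x. (cmod (f x))\<^sup>2)"
  using assms by (auto simp: L2_fun_def)

lemma cmod_add_sq_le: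
  fixes u v :: complex and a b :: real
  assumes "a > 0" "b > 0"
  shows "(cmod (u + v))\<^sup>2 \<le> (1 + b / a) * (cmod u)\<^sup>2 + (1 + a / b) * (cmod v)\<^sup>2"
proof -
  have "(cmod (u + v))\<^sup>2 \<le> (cmod u + cmod v)\<^sup>2"
    by (intro power_mono norm_triangle_ineq) auto
  moreover have "0 \<le> (b * cmod u - a * cmod v)\<^sup>2 / (a * b)"
    using assms by auto
  moreover have "(b * cmod u - a * cmod v)\<^sup>2 / (a * b)
      = (b / a) * (cmod u)\<^sup>2 + (a / b) * (cmod v)\<^sup>2 - 2 * cmod u * cmod v"
    using assms by (simp add: field_simps power2_eq_square)
  ultimately show ?thesis
    by (simp add: power2_sum algebra_simps)
qed

lemma L2_fun_add:
  assumes f: "f \<in> L2_fun M" and g: "g \<in> L2_fun M"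
  shows "(\<lambda>x. f x + g x) \<in> L2_fun M"
proof -
  have [measurable]: "f \<in> borel_measurable M" "g \<in> borel_measurable M"
    using f g by (auto dest: L2_funD)
  have "integrable M (\<lambda>x. 2 * (cmod (f x))\<^sup>2 + 2 * (cmod (g x))\<^sup>2)"
    using f g by (intro Bochner_Integration.integrable_add integrable_mult_right L2_funD)
  then have "integrable M (\<lambda>x. (cmod (f x + g x))\<^sup>2)"
  proof (rule Bochner_Integration.integrable_bound)
    show "AE x in M. norm ((cmod (f x + g x))\<^sup>2)
        \<le> norm (2 * (cmod (f x))\<^sup>2 + 2 * (cmod (g x))\<^sup>2)"
      using cmod_add_sq_le[of 1 1] by auto
  qed measurable
  then show ?thesis
    by (simp add: L2_fun_def)
qed

lemma L2_fun_uminus: "f \<in> L2_fun M \<Longrightarrow> (\<lambda>x. - f x) \<in> L2_fun M"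
  by (auto simp: L2_fun_def)

lemma L2_fun_diff:
  assumes "f \<in> L2_fun M" "g \<in> L2_fun M"
  shows "(\<lambda>x. f x - g x) \<in> L2_fun M"
  using L2_fun_add[OF assms(1) L2_fun_uminus[OF assms(2)]] by simp

lemma L2_norm_nonneg: "L2_norm M f \<ge> 0"
  by (simp add: L2_norm_def)

lemma L2_norm_sq: "(L2_norm M f)\<^sup>2 = (\<integral>x. (cmod (f x))\<^sup>2 \<partial>M)"
  by (simp add: L2_norm_def)

lemma L2_norm_cong_AE:
  assumes "f \<in> L2_fun M" "g \<in> L2_fun M" "AE x in M. f x = g x"
  shows "L2_norm M f = L2_norm M g"
proof -
  have [measurable]: "f \<in> borel_measurable M" "g \<in> borel_measurable M"
    using assms by (auto dest: L2_funD)
  have "(\<integral>x. (cmod (f x))\<^sup>2 \<partial>M) = (\<integral>x. (cmod (g x))\<^sup>2 \<partial>M)"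
    using assms(3) by (intro integral_cong_AE) auto
  then show ?thesis
    by (simp add: L2_norm_def)
qed

lemma L2_norm_eq_0_iff:
  assumes "f \<in> L2_fun M"
  shows "L2_norm M f = 0 \<longleftrightarrow> (AE x in M. f x = 0)"
  using integral_nonneg_eq_0_iff_AE[OF L2_funD(2)[OF assms]] by (simp add: L2_norm_def)

lemma L2_norm_triangle:
  assumes f: "f \<in> L2_fun M" and g: "g \<in> L2_fun M"
  shows "L2_norm M (\<lambda>x. f x + g x) \<le> L2_norm M f + L2_norm M g"
proof (rule field_le_epsilon)
  fix e :: real assume e: "e > 0"
  define a b where "a = L2_norm M f + e / 2" and "b = L2_norm M g + e / 2"
  have pos: "a > 0" "b > 0"
    using e L2_norm_nonneg[of M f] L2_norm_nonneg[of M g] by (auto simp: a_def b_def)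
  have le: "(L2_norm M f)\<^sup>2 \<le> a\<^sup>2" "(L2_norm M g)\<^sup>2 \<le> b\<^sup>2"
    using e L2_norm_nonneg[of M f] L2_norm_nonneg[of M g]
    by (auto simp: a_def b_def intro!: power_mono)
  have "(L2_norm M (\<lambda>x. f x + g x))\<^sup>2
      \<le> (\<integral>x. (1 + b / a) * (cmod (f x))\<^sup>2 + (1 + a / b) * (cmod (g x))\<^sup>2 \<partial>M)"
    unfolding L2_norm_sq using f g L2_fun_add[OF f g]
    by (intro integral_mono cmod_add_sq_le pos Bochner_Integration.integrable_add
        integrable_mult_right L2_funD(2))
  also have "\<dots> = (1 + b / a) * (L2_norm M f)\<^sup>2 + (1 + a / b) * (L2_norm M g)\<^sup>2"
    unfolding L2_norm_sq using f g by (subst Bochner_Integration.integral_add) (auto dest: L2_funD)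
  also have "\<dots> \<le> (1 + b / a) * a\<^sup>2 + (1 + a / b) * b\<^sup>2"
    using pos le by (intro add_mono mult_left_mono) auto
  also have "\<dots> = (a + b)\<^sup>2"
    using pos by (simp add: field_simps power2_eq_square)
  finally have "L2_norm M (\<lambda>x. f x + g x) \<le> a + b"
    using pos by (meson add_pos_pos less_imp_le power2_le_imp_le)
  then show "L2_norm M (\<lambda>x. f x + g x) \<le> L2_norm M f + L2_norm M g + e"
    by (simp add: a_def b_def)
qed

lemma L2_class_self: "f \<in> L2_fun M \<Longrightarrow> f \<in> L2_class M f"
  by (simp add: L2_class_def)

lemma L2_class_in_space: "f \<in> L2_fun M \<Longrightarrow> L2_class M f \<in> L2_space M"
  by (simp add: L2_space_def)

lemma L2_class_eq_iff:
  assumes "f \<in> L2_fun M" "g \<in> L2_fun M"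
  shows "L2_class M f = L2_class M g \<longleftrightarrow> (AE x in M. f x = g x)"
proof
  assume "L2_class M f = L2_class M g"
  then have "f \<in> L2_class M g"
    using L2_class_self[OF assms(1)] by simp
  then show "AE x in M. f x = g x"
    by (simp add: L2_class_def)
next
  assume *: "AE x in M. f x = g x"
  have "(AE x in M. h x = f x) \<longleftrightarrow> (AE x in M. h x = g x)" for h
    using * by (auto elim: eventually_elim2)
  then show "L2_class M f = L2_class M g"
    by (simp add: L2_class_def)
qed

lemma L2_dist_class:
  assumes f: "f \<in> L2_fun M" and g: "g \<in> L2_fun M"
  shows "L2_dist M (L2_class M f) (L2_class M g) = L2_norm M (\<lambda>x. f x - g x)"
proof -
  define f' where "f' = (SOME h. h \<in> L2_class M f)"
  define g' where "g' = (SOME h. h \<in> L2_class M g)"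
  have f': "f' \<in> L2_class M f"
    unfolding f'_def using L2_class_self[OF f] by (rule someI[where P = "\<lambda>h. h \<in> L2_class M f"])
  have g': "g' \<in> L2_class M g"
    unfolding g'_def using L2_class_self[OF g] by (rule someI[where P = "\<lambda>h. h \<in> L2_class M g"])
  have "L2_norm M (\<lambda>x. f' x - g' x) = L2_norm M (\<lambda>x. f x - g x)"
    using f' g' f g by (intro L2_norm_cong_AE L2_fun_diff) (auto simp: L2_class_def)
  then show ?thesis
    by (simp add: L2_dist_def f'_def g'_def)
qed

lemma Metric_space_L2: "Metric_space (L2_space M) (L2_dist M)"
proof
  show "0 \<le> L2_dist M F G" for F G
    by (simp add: L2_dist_def L2_norm_nonneg)
  show "L2_dist M F G = L2_dist M G F" for F G
    by (simp add: L2_dist_def L2_norm_def norm_minus_commute)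
  show "L2_dist M F G = 0 \<longleftrightarrow> F = G" if FG: "F \<in> L2_space M" "G \<in> L2_space M" for F G
  proof -
    obtain f g where *: "f \<in> L2_fun M" "g \<in> L2_fun M" "F = L2_class M f" "G = L2_class M g"
      using FG unfolding L2_space_def by blast
    show ?thesis
      using * by (simp add: L2_dist_class L2_norm_eq_0_iff L2_fun_diff L2_class_eq_iff)
  qed
  show "L2_dist M F H \<le> L2_dist M F G + L2_dist M G H"
    if FG: "F \<in> L2_space M" "G \<in> L2_space M" "H \<in> L2_space M" for F G H
  proof -
    obtain f g h where *: "f \<in> L2_fun M" "g \<in> L2_fun M" "h \<in> L2_fun M"
        "F = L2_class M f" "G = L2_class M g" "H = L2_class M h"
      using FG unfolding L2_space_def by blast
    show ?thesis
      using * L2_norm_triangle[of "\<lambda>x. f x - g x" M "\<lambda>x. g x - h x"]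
      by (simp add: L2_dist_class L2_fun_diff)
  qed
qed

lemma topspace_L2: "topspace (L2_topology M) = L2_space M"
  by (simp add: L2_topology_def Metric_space.topspace_mtopology[OF Metric_space_L2])


section \<open>Independence of the width of the strip\<close>

lemma strip_cover:
  assumes "b > 0"
  obtains F where "finite F" "\<And>v. v \<in> strip \<beta> b' \<Longrightarrow> \<exists>w\<in>F. v - w \<in> strip \<beta> b"
proof -
  define d where "d v = real_of_int (snd v) - \<beta> * of_int (fst v)" for v :: "int \<times> int"
  have strip: "strip \<beta> c = {v. \<bar>d v\<bar> \<le> c}" for c
    by (auto simp: strip_def d_def abs_le_iff algebra_simps)
  define q where "q v = \<lfloor>d v / b\<rfloor>" for v
  define J where "J = q ` strip \<beta> b'"
  define r where "r j = (SOME v. v \<in> strip \<beta> b' \<and> q v = j)" for j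
  have r: "r (q v) \<in> strip \<beta> b' \<and> q (r (q v)) = q v" if "v \<in> strip \<beta> b'" for v
    unfolding r_def by (rule someI[of _ v]) (use that in auto)
  have "J \<subseteq> {\<lfloor>- b' / b\<rfloor> .. \<lfloor>b' / b\<rfloor>}"
  proof
    fix j assume "j \<in> J"
    then obtain v where v: "\<bar>d v\<bar> \<le> b'" "j = \<lfloor>d v / b\<rfloor>"
      unfolding J_def q_def strip by blast
    have "- b' / b \<le> d v / b" "d v / b \<le> b' / b"
      using v(1) assms by (intro divide_right_mono; simp)+
    then show "j \<in> {\<lfloor>- b' / b\<rfloor> .. \<lfloor>b' / b\<rfloor>}"
      unfolding v(2) atLeastAtMost_iff by (intro conjI floor_mono)
  qed
  then have "finite J"
    using finite_subset by blast
  show thesis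
  proof
    show "finite (r ` J)"
      using \<open>finite J\<close> by simp
    fix v assume v: "v \<in> strip \<beta> b'"
    have "q (r (q v)) = q v"
      using r[OF v] by simp
    then have "\<bar>d v / b - d (r (q v)) / b\<bar> \<le> 1"
      unfolding q_def by linarith
    then have "\<bar>d v - d (r (q v))\<bar> \<le> b"
      using assms by (simp add: diff_divide_distrib[symmetric] abs_divide)
    then have "v - r (q v) \<in> strip \<beta> b"
      unfolding strip by (simp add: d_def algebra_simps)
    then show "\<exists>w\<in>r ` J. v - w \<in> strip \<beta> b"
      using v by (auto simp: J_def)
  qed
qed

context Z2_mpds
begin

lemma T_measurable [measurable]: "T v \<in> M \<rightarrow>\<^sub>M M"
proof -
  have "continuous_on UNIV (T v)"
    using homeomorphism_T[of v] by (auto simp: homeomorphism_def)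
  then have "T v \<in> borel \<rightarrow>\<^sub>M borel"
    by (rule borel_measurable_continuous_onI)
  then show ?thesis
    using measurable_cong_sets[OF sets_eq_borel sets_eq_borel] by auto
qed

lemma koopman_add: "koopman T (v + w) f = koopman T w (koopman T v f)"
  by (simp add: koopman_def T_add comp_assoc)

lemma koopman_L2_fun:
  assumes "f \<in> L2_fun M"
  shows "koopman T v f \<in> L2_fun M"
proof -
  have [measurable]: "f \<in> borel_measurable M"
    using assms by (rule L2_funD)
  have "integrable (distr M M (T v)) (\<lambda>x. (cmod (f x))\<^sup>2)"
    using L2_funD(2)[OF assms] by (simp add: T_invariant)
  then have "integrable M (\<lambda>x. (cmod (f (T v x)))\<^sup>2)"
    by (subst (asm) integrable_distr_eq) measurable
  then show ?thesis
    by (simp add: L2_fun_def koopman_def comp_def)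
qed

lemma L2_norm_koopman:
  assumes "f \<in> L2_fun M"
  shows "L2_norm M (koopman T v f) = L2_norm M f"
proof -
  have [measurable]: "f \<in> borel_measurable M"
    using assms by (rule L2_funD)
  have "(\<integral>x. (cmod (f x))\<^sup>2 \<partial>distr M M (T v)) = (\<integral>x. (cmod (f (T v x)))\<^sup>2 \<partial>M)"
    by (rule integral_distr) measurable
  then show ?thesis
    by (simp add: L2_norm_def koopman_def T_invariant)
qed

lemma indicator_L2_fun: "B \<in> sets M \<Longrightarrow> indicator B \<in> L2_fun M"
proof -
  assume B: "B \<in> sets M"
  have "(\<lambda>x. (cmod (indicator B x))\<^sup>2) = (indicator B :: 'a \<Rightarrow> real)"
    by (auto simp: indicator_def)
  then show ?thesis
    using B by (simp add: L2_fun_def emeasure_eq_measure)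
qed

definition koopman_class :: "int \<times> int \<Rightarrow> ('a \<Rightarrow> complex) set \<Rightarrow> ('a \<Rightarrow> complex) set" where
  "koopman_class v F = L2_class M (koopman T v (SOME f. f \<in> F))"

lemma koopman_class_eq:
  assumes f: "f \<in> L2_fun M"
  shows "koopman_class v (L2_class M f) = L2_class M (koopman T v f)"
proof -
  define g where "g = (SOME h. h \<in> L2_class M f)"
  have "g \<in> L2_class M f"
    unfolding g_def using L2_class_self[OF f] by (rule someI[where P = "\<lambda>h. h \<in> L2_class M f"])
  then have g: "g \<in> L2_fun M" "AE x in M. g x = f x"
    by (auto simp: L2_class_def)
  have "L2_norm M (koopman T v (\<lambda>x. g x - f x)) = 0"
    using g f by (simp add: L2_norm_koopman L2_norm_eq_0_iff L2_fun_diff)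
  then have "AE x in M. koopman T v (\<lambda>x. g x - f x) x = 0"
    using g f by (simp add: L2_norm_eq_0_iff koopman_L2_fun L2_fun_diff)
  then have "L2_class M (koopman T v g) = L2_class M (koopman T v f)"
    using g f by (simp add: L2_class_eq_iff koopman_L2_fun) (simp add: koopman_def)
  then show ?thesis
    by (simp add: koopman_class_def g_def)
qed

lemma continuous_koopman_class:
  "continuous_map (L2_topology M) (L2_topology M) (koopman_class v)"
proof -
  have space: "koopman_class v F \<in> L2_space M" if "F \<in> L2_space M" for F
    using that by (auto simp: L2_space_def koopman_class_eq koopman_L2_fun)
  have iso: "L2_dist M (koopman_class v F) (koopman_class v G) = L2_dist M F G"
    if FG: "F \<in> L2_space M" "G \<in> L2_space M" for F G
  proof -
    obtain f g where *: "f \<in> L2_fun M" "g \<in> L2_fun M" "F = L2_class M f" "G = L2_class M g"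
      using FG unfolding L2_space_def by blast
    have "L2_norm M (\<lambda>x. koopman T v f x - koopman T v g x)
        = L2_norm M (koopman T v (\<lambda>x. f x - g x))"
      by (simp add: koopman_def comp_def)
    then show ?thesis
      using * by (simp add: koopman_class_eq L2_dist_class koopman_L2_fun L2_norm_koopman L2_fun_diff)
  qed
  show ?thesis
    unfolding L2_topology_def
    by (subst Metric_space.metric_continuous_map[OF Metric_space_L2 Metric_space_L2])
       (use space iso in \<open>auto intro!: exI\<close>)
qed

lemma compactin_strip_closure:
  assumes B: "B \<in> sets M" and b: "b > 0"
    and comp: "compactin (L2_topology M)
      (L2_topology M closure_of ((\<lambda>v. L2_class M (koopman T v (indicator B))) ` strip \<beta> b))"
  shows "compactin (L2_topology M)
      (L2_topology M closure_of ((\<lambda>v. L2_class M (koopman T v (indicator B))) ` strip \<beta> b'))"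
proof -
  let ?X = "L2_topology M"
  let ?orb = "\<lambda>v. L2_class M (koopman T v (indicator B))"
  let ?C = "?X closure_of (?orb ` strip \<beta> b)"
  obtain F where F: "finite F" "\<And>v. v \<in> strip \<beta> b' \<Longrightarrow> \<exists>w\<in>F. v - w \<in> strip \<beta> b"
    using strip_cover[OF b] by blast
  define K where "K = (\<Union>w\<in>F. koopman_class w ` ?C)"
  have K: "compactin ?X K"
    unfolding K_def using F(1) comp
    by (intro compactin_Union) (auto intro!: image_compactin continuous_koopman_class)
  have "Hausdorff_space ?X"
    by (simp add: L2_topology_def Metric_space.Hausdorff_space_mtopology[OF Metric_space_L2])
  then have closed: "closedin ?X K"
    using K by (rule compactin_imp_closedin)
  have orb_sub: "?orb ` strip \<beta> b \<subseteq> ?C"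
    by (intro closure_of_subset)
       (auto simp: topspace_L2 intro!: L2_class_in_space koopman_L2_fun indicator_L2_fun B)
  have "?orb ` strip \<beta> b' \<subseteq> K"
  proof
    fix G assume "G \<in> ?orb ` strip \<beta> b'"
    then obtain v where v: "v \<in> strip \<beta> b'" "G = ?orb v"
      by blast
    then obtain w where w: "w \<in> F" "v - w \<in> strip \<beta> b"
      using F(2) by blast
    have "G = ?orb (v - w + w)"
      by (simp add: v)
    also have "\<dots> = koopman_class w (?orb (v - w))"
      unfolding koopman_add by (simp add: koopman_class_eq koopman_L2_fun indicator_L2_fun B)
    finally show "G \<in> K"
      unfolding K_def using w orb_sub by blast
  qed
  then have "?X closure_of (?orb ` strip \<beta> b') \<subseteq> K"
    using closed by (rule closure_of_minimal)
  then show ?thesis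
    using K closed_compactin closedin_closure_of by blast
qed

theorem directional_kronecker_eq:
  assumes "b > 0"
  shows "directional_kronecker M T \<beta> = {B \<in> sets M. compactin (L2_topology M)
     (L2_topology M closure_of ((\<lambda>v. L2_class M (koopman T v (indicator B))) ` strip \<beta> b))}"
  unfolding directional_kronecker_def using compactin_strip_closure assms by blast

end

end

theory Submission
  imports Defs
begin

text \<open>
  The substantial implication is that weak mixing forces decay of correlations. Suppose that \<open>f\<close> has
  mean zero and that the averages of \<open>\<bar>\<langle>U\<^sup>v f, h\<rangle>\<bar>\<close> do not tend to zero. Consider the finite rank operators
  \<open>A\<^sub>c x = \<Sum>\<^sub>v c\<^sub>v \<langle>x, U\<^sup>v f\<rangle> U\<^sup>v f\<close>, where the weights \<open>c\<close> average over long windows of the strip and are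
  tapered across it. Conjugating \<open>A\<^sub>c\<close> by \<open>U\<^sup>u\<close> translates \<open>c\<close> by \<open>u\<close>, which changes it little in \<open>l\<^sup>1\<close> when
  \<open>u\<close> is close to the line and the window is long. The admissible weights form a decreasing sequence of
  convex sets, so, by the parallelogram law, weights that almost minimise the Hilbert-Schmidt norm of
  \<open>A\<^sub>c\<close> yield a Cauchy sequence of operators. The limit \<open>e\<close> of \<open>A\<^sub>c h\<close> then satisfies \<open>\<langle>e, h\<rangle> \<noteq> 0\<close>, has mean
  zero, and has a precompact orbit along every strip: for \<open>u\<close> close to the line, \<open>U\<^sup>u e\<close> is close to
  \<open>A\<^sub>c (U\<^sup>u h)\<close>, which lies in a bounded subset of a fixed finite-dimensional space, and finitely many
  translates of a thin strip cover a wide one. Since \<open>e\<close> is not almost everywhere zero, one of the sets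
  \<open>{Re e > 0}\<close>, \<open>{Im e > 0}\<close> is nontrivial, and it belongs to the Kronecker algebra.

  Conversely, let \<open>B\<close> be in the Kronecker algebra and \<open>f = 1\<^sub>B - \<mu>(B)\<close>. A finite net in the orbit of \<open>f\<close> along
  the strip of width \<open>b/2\<close> keeps \<open>\<bar>\<langle>U\<^sup>v f, f\<rangle>\<bar>\<close> bounded away from zero on a relatively dense subset of the
  strip of width \<open>b\<close>, unless \<open>f = 0\<close>.
\<close>

section \<open>The Hilbert space structure of \<open>L\<^sup>2\<close>\<close>

lemma L2_fun_zero: "(\<lambda>_. 0) \<in> L2_fun M"
  by (simp add: L2_fun_def)

lemma L2_fun_cmult:
  assumes "f \<in> L2_fun M"
  shows "(\<lambda>x. c * f x) \<in> L2_fun M"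
  using assms by (auto simp: L2_fun_def norm_mult power_mult_distrib)

lemma L2_fun_sum:
  assumes "\<And>i. i \<in> I \<Longrightarrow> f i \<in> L2_fun M"
  shows "(\<lambda>x. \<Sum>i\<in>I. f i x) \<in> L2_fun M"
  using assms by (induction I rule: infinite_finite_induct) (auto intro: L2_fun_zero L2_fun_add)

lemma L2_fun_lincomb:
  assumes "\<And>i. i \<in> I \<Longrightarrow> f i \<in> L2_fun M"
  shows "(\<lambda>x. \<Sum>i\<in>I. c i * f i x) \<in> L2_fun M"
  using assms by (intro L2_fun_sum L2_fun_cmult)

lemma L2_fun_dominated:
  assumes "f \<in> L2_fun M" "g \<in> borel_measurable M" "\<And>x. x \<in> space M \<Longrightarrow> cmod (g x) \<le> cmod (f x)"
  shows "g \<in> L2_fun M"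
proof -
  have "integrable M (\<lambda>x. (cmod (g x))\<^sup>2)"
    by (rule Bochner_Integration.integrable_bound[OF L2_funD(2)[OF assms(1)]])
       (use assms in \<open>auto intro!: AE_I2 power_mono\<close>)
  then show ?thesis
    using assms by (simp add: L2_fun_def)
qed

lemma L2_norm_mono:
  assumes "f \<in> L2_fun M" "g \<in> borel_measurable M" "\<And>x. x \<in> space M \<Longrightarrow> cmod (g x) \<le> cmod (f x)"
  shows "L2_norm M g \<le> L2_norm M f"
  unfolding L2_norm_def
  by (intro real_sqrt_le_mono integral_mono L2_funD(2)[OF assms(1)]
      L2_funD(2)[OF L2_fun_dominated[OF assms]] power_mono assms) auto

lemma L2_norm_cmult: "L2_norm M (\<lambda>x. c * f x) = cmod c * L2_norm M f"
  by (simp add: L2_norm_def norm_mult power_mult_distrib real_sqrt_mult)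

lemma L2_norm_minus_commute: "L2_norm M (\<lambda>x. f x - g x) = L2_norm M (\<lambda>x. g x - f x)"
  by (simp add: L2_norm_def norm_minus_commute)

lemma L2_norm_triangle_diff:
  assumes "f \<in> L2_fun M" "g \<in> L2_fun M" "h \<in> L2_fun M"
  shows "L2_norm M (\<lambda>x. f x - h x) \<le> L2_norm M (\<lambda>x. f x - g x) + L2_norm M (\<lambda>x. g x - h x)"
  using L2_norm_triangle[of "\<lambda>x. f x - g x" M "\<lambda>x. g x - h x"] assms by (simp add: L2_fun_diff)

lemma L2_norm_sum:
  assumes "\<And>i. i \<in> I \<Longrightarrow> f i \<in> L2_fun M"
  shows "L2_norm M (\<lambda>x. \<Sum>i\<in>I. f i x) \<le> (\<Sum>i\<in>I. L2_norm M (f i))"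
  using assms
proof (induction I rule: infinite_finite_induct)
  case (insert i I)
  have "L2_norm M (\<lambda>x. f i x + (\<Sum>i\<in>I. f i x)) \<le> L2_norm M (f i) + L2_norm M (\<lambda>x. \<Sum>i\<in>I. f i x)"
    using insert by (intro L2_norm_triangle L2_fun_sum) auto
  with insert show ?case
    by fastforce
qed (auto simp: L2_norm_def)

section \<open>Inner products of square integrable functions\<close>

lemma integrable_L2_mult:
  assumes f: "f \<in> L2_fun M" and g: "g \<in> L2_fun M"
  shows "integrable M (\<lambda>x. f x * cnj (g x))"
proof (rule Bochner_Integration.integrable_bound)
  show "integrable M (\<lambda>x. (cmod (f x))\<^sup>2 + (cmod (g x))\<^sup>2)"
    using f g by (intro Bochner_Integration.integrable_add L2_funD)
  have "cmod u * cmod v \<le> (cmod u)\<^sup>2 + (cmod v)\<^sup>2" for u v :: complex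
    using sum_squares_bound[of "cmod u" "cmod v"]
      mult_nonneg_nonneg[OF norm_ge_zero[of u] norm_ge_zero[of v]] by linarith
  then show "AE x in M. norm (f x * cnj (g x)) \<le> norm ((cmod (f x))\<^sup>2 + (cmod (g x))\<^sup>2)"
    by (simp add: norm_mult)
  have [measurable]: "f \<in> borel_measurable M" "g \<in> borel_measurable M"
    using f g by (auto dest: L2_funD)
  have [measurable]: "cnj \<in> borel_measurable borel"
    by (intro borel_measurable_continuous_onI continuous_intros)
  show "(\<lambda>x. f x * cnj (g x)) \<in> borel_measurable M"
    by measurable
qed

lemma L2_inner_commute: "L2_inner M g f = cnj (L2_inner M f g)"
  using Bochner_Integration.integral_cnj[of M "\<lambda>x. f x * cnj (g x)"]
  by (simp add: L2_inner_def mult.commute del: Bochner_Integration.integral_cnj)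

lemma L2_inner_diff_left:
  assumes "f \<in> L2_fun M" "g \<in> L2_fun M" "h \<in> L2_fun M"
  shows "L2_inner M (\<lambda>x. f x - g x) h = L2_inner M f h - L2_inner M g h"
  using integrable_L2_mult[OF assms(1,3)] integrable_L2_mult[OF assms(2,3)]
  by (simp add: L2_inner_def left_diff_distrib)

lemma L2_inner_cmult_left: "L2_inner M (\<lambda>x. c * f x) h = c * L2_inner M f h"
  by (simp add: L2_inner_def mult.assoc)

lemma L2_inner_lincomb_left:
  assumes "\<And>i. i \<in> I \<Longrightarrow> f i \<in> L2_fun M" "h \<in> L2_fun M"
  shows "L2_inner M (\<lambda>x. \<Sum>i\<in>I. c i * f i x) h = (\<Sum>i\<in>I. c i * L2_inner M (f i) h)"
  using assms by (simp add: L2_inner_def sum_distrib_right mult.assoc integral_sum integrable_L2_mult)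

lemma L2_inner_lincomb_right:
  assumes "\<And>i. i \<in> I \<Longrightarrow> f i \<in> L2_fun M" "h \<in> L2_fun M"
  shows "L2_inner M h (\<lambda>x. \<Sum>i\<in>I. c i * f i x) = (\<Sum>i\<in>I. cnj (c i) * L2_inner M h (f i))"
  by (subst L2_inner_commute, subst L2_inner_lincomb_left[OF assms], assumption)
     (simp add: L2_inner_commute[of M h])

lemma L2_inner_self: "L2_inner M f f = of_real ((L2_norm M f)\<^sup>2)"
  unfolding L2_norm_sq L2_inner_def
  by (simp flip: integral_complex_of_real add: complex_norm_square[symmetric])

lemma L2_norm_diff_sq:
  assumes f: "f \<in> L2_fun M" and g: "g \<in> L2_fun M"
  shows "(L2_norm M (\<lambda>x. f x - s * g x))\<^sup>2
    = (L2_norm M f)\<^sup>2 - 2 * Re (cnj s * L2_inner M f g) + (cmod s)\<^sup>2 * (L2_norm M g)\<^sup>2"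
proof -
  let ?D = "\<lambda>x. f x - s * g x"
  have sg: "(\<lambda>x. s * g x) \<in> L2_fun M"
    using g by (rule L2_fun_cmult)
  have D: "?D \<in> L2_fun M"
    by (rule L2_fun_diff[OF f sg])
  have "L2_inner M ?D ?D = L2_inner M f ?D - s * L2_inner M g ?D"
    using L2_inner_diff_left[OF f sg D] by (simp add: L2_inner_cmult_left)
  also have "L2_inner M f ?D = cnj (L2_inner M f f - s * L2_inner M g f)"
    by (subst L2_inner_commute) (simp add: L2_inner_diff_left f sg L2_inner_cmult_left)
  also have "L2_inner M g ?D = cnj (L2_inner M f g - s * L2_inner M g g)"
    by (subst L2_inner_commute) (simp add: L2_inner_diff_left f g sg L2_inner_cmult_left)
  finally have "Re (L2_inner M ?D ?D) = Re (cnj (L2_inner M f f - s * L2_inner M g f)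
      - s * cnj (L2_inner M f g - s * L2_inner M g g))"
    by simp
  then show ?thesis
    unfolding L2_inner_self L2_inner_commute[of M g f]
    by (simp only: cmod_power2) (simp add: algebra_simps power2_eq_square)
qed

text \<open>For \<open>c > 0\<close> the quadratic is evaluated at its minimum
  \<open>t = b / c\<close>. For \<open>c = 0\<close> it is affine in \<open>t\<close>, and a nonzero
  \<open>b\<close> would let it take the value -1.\<close>

lemma nonneg_quadratic_discriminant:
  fixes a b c :: real
  assumes "\<And>t. 0 \<le> a - 2 * t * b + t\<^sup>2 * c" "0 \<le> c"
  shows "b\<^sup>2 \<le> a * c"
proof (cases "c = 0")
  case True
  have "b = 0"
  proof (rule ccontr)
    assume "b \<noteq> 0"
    then show False
      using assms(1)[of "(a + 1) / (2 * b)"] True by simp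
  qed
  with True show ?thesis by simp
next
  case False
  then show ?thesis
    using assms(1)[of "b / c"] assms(2) by (simp add: field_simps power2_eq_square)
qed

text \<open>Cancels a factor that may vanish, so that the Cauchy-Schwarz arguments need no separate
  degenerate case.\<close>

lemma mult_self_le_imp_le:
  fixes a b :: real
  assumes "a * a \<le> a * b" "0 \<le> a" "0 \<le> b"
  shows "a \<le> b"
  using assms by (cases "a = 0") (auto simp: mult_le_cancel_left)

lemma L2_Cauchy_Schwarz:
  assumes f: "f \<in> L2_fun M" and g: "g \<in> L2_fun M"
  shows "cmod (L2_inner M f g) \<le> L2_norm M f * L2_norm M g"
proof -
  define z where "z = L2_inner M f g"
  \<comment> \<open>This is the squared norm of \<open>f - t z g\<close> with \<open>t\<close> real:
    putting the phase of \<open>z\<close> into the multiplier makes the cross term real.\<close>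
  have "0 \<le> (L2_norm M f)\<^sup>2 - 2 * t * (cmod z)\<^sup>2 + t\<^sup>2 * ((cmod z)\<^sup>2 * (L2_norm M g)\<^sup>2)" for t :: real
  proof -
    have "Re (cnj (of_real t * z) * L2_inner M f g) = t * (cmod z)\<^sup>2"
      unfolding z_def[symmetric] by (simp add: cmod_power2) (simp add: algebra_simps power2_eq_square)
    then show ?thesis
      using L2_norm_diff_sq[OF f g, of "of_real t * z"]
        zero_le_power2[of "L2_norm M (\<lambda>x. f x - of_real t * z * g x)"]
      by (simp only: norm_mult power_mult_distrib norm_of_real power2_abs mult.assoc)
  qed
  then have "((cmod z)\<^sup>2)\<^sup>2 \<le> (L2_norm M f)\<^sup>2 * ((cmod z)\<^sup>2 * (L2_norm M g)\<^sup>2)"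
    by (rule nonneg_quadratic_discriminant) auto
  then have "(cmod z)\<^sup>2 * (cmod z)\<^sup>2 \<le> (cmod z)\<^sup>2 * (L2_norm M f * L2_norm M g)\<^sup>2"
    by (simp only: power_mult_distrib mult_ac power2_eq_square)
  then have "(cmod z)\<^sup>2 \<le> (L2_norm M f * L2_norm M g)\<^sup>2"
    by (rule mult_self_le_imp_le) auto
  then show ?thesis
    unfolding z_def by (rule power2_le_imp_le) (simp add: L2_norm_nonneg)
qed

text \<open>
  \<open>\<Sum>\<^sub>i\<^sub>j c\<^sub>i c\<^sub>j \<bar>\<langle>g\<^sub>i, g\<^sub>j\<rangle>\<bar>\<^sup>2\<close> is the squared Hilbert-Schmidt norm of \<open>h \<mapsto> \<Sum>\<^sub>i c\<^sub>i \<langle>h, g\<^sub>i\<rangle> g\<^sub>i\<close>, so the lemma bounds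
  the operator norm by the Hilbert-Schmidt norm. The proof is the Cauchy-Schwarz inequality for the
  kernels \<open>\<Sum>\<^sub>i c\<^sub>i g\<^sub>i(x) cnj g\<^sub>i(y)\<close> and \<open>u(x) cnj h(y)\<close> with \<open>u\<close> the image of \<open>h\<close>.
\<close>

lemma L2_norm_finite_rank_le:
  fixes c :: "'i \<Rightarrow> real"
  assumes g: "\<And>i. i \<in> I \<Longrightarrow> g i \<in> L2_fun M" and h: "h \<in> L2_fun M"
  shows "(L2_norm M (\<lambda>x. \<Sum>i\<in>I. of_real (c i) * L2_inner M h (g i) * g i x))\<^sup>2
    \<le> (\<Sum>i\<in>I. \<Sum>j\<in>I. c i * c j * (cmod (L2_inner M (g i) (g j)))\<^sup>2) * (L2_norm M h)\<^sup>2"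
    and "0 \<le> (\<Sum>i\<in>I. \<Sum>j\<in>I. c i * c j * (cmod (L2_inner M (g i) (g j)))\<^sup>2)"
proof -
  define u where "u = (\<lambda>x. \<Sum>i\<in>I. (of_real (c i) * L2_inner M h (g i)) * g i x)"
  define Q where "Q = (\<Sum>i\<in>I. \<Sum>j\<in>I. c i * c j * (cmod (L2_inner M (g i) (g j)))\<^sup>2)"
  \<comment> \<open>Fubini is avoided by treating one variable at a time. For fixed
    \<open>x\<close>, \<open>P x\<close> is the squared norm of the section \<open>F\<close> of the
    kernel defined below, and \<open>S x\<close> is \<open>u x\<close> times the inner product of
    \<open>F\<close> with \<open>h\<close>. Integration over \<open>x\<close> turns \<open>P\<close>
    into \<open>Q\<close> and \<open>S\<close> into \<open>||u||^2\<close>.\<close>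
  define P where "P x = (\<Sum>i\<in>I. \<Sum>j\<in>I. (of_real (c i * c j) * L2_inner M (g i) (g j)) * (g j x * cnj (g i x)))" for x
  define S where "S x = (\<Sum>i\<in>I. (of_real (c i) * L2_inner M (g i) h) * (u x * cnj (g i x)))" for x
  have u: "u \<in> L2_fun M"
    unfolding u_def using g by (rule L2_fun_lincomb)
  have int_P: "integrable M P" and int_S: "integrable M S"
    unfolding P_def S_def using g u by (intro Bochner_Integration.integrable_sum integrable_mult_right integrable_L2_mult; simp)+
  have "(\<integral>x. P x \<partial>M) = (\<Sum>i\<in>I. \<Sum>j\<in>I. (of_real (c i * c j) * L2_inner M (g i) (g j)) * L2_inner M (g j) (g i))"
    unfolding P_def L2_inner_def[of M "g _" "g _"]
    by (simp add: integral_sum integrable_L2_mult g Bochner_Integration.integrable_sum)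
  also have "\<dots> = of_real Q"
    unfolding Q_def of_real_sum
    by (intro sum.cong refl) (subst (2) L2_inner_commute, simp only: mult.assoc complex_norm_square[symmetric] of_real_mult of_real_power)
  finally have P: "(\<integral>x. P x \<partial>M) = of_real Q" .
  have "(\<integral>x. S x \<partial>M) = (\<Sum>i\<in>I. (of_real (c i) * L2_inner M (g i) h) * L2_inner M u (g i))"
    unfolding S_def L2_inner_def[of M u "g _"]
    by (simp add: integral_sum integrable_L2_mult g u)
  also have "\<dots> = L2_inner M u u"
    by (subst (2) u_def, subst L2_inner_lincomb_right[OF g u], assumption)
       (simp add: L2_inner_commute[of M h])
  finally have S: "(\<integral>x. S x \<partial>M) = of_real ((L2_norm M u)\<^sup>2)"
    by (simp add: L2_inner_self)
  have nonneg: "0 \<le> Q - 2 * t * (L2_norm M u)\<^sup>2 + t\<^sup>2 * ((L2_norm M u)\<^sup>2 * (L2_norm M h)\<^sup>2)" for t :: real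
  proof -
    \<comment> \<open>\<open>R x\<close> is the squared norm of \<open>F - t cnj(u x) h\<close>,
      hence nonnegative; its integral is the quadratic in \<open>t\<close> required above.\<close>
    define R where "R x = Re (P x) - 2 * t * Re (S x) + (t\<^sup>2 * (L2_norm M h)\<^sup>2) * (cmod (u x))\<^sup>2" for x
    have "0 \<le> R x" for x
    proof -
      define F where "F = (\<lambda>y. \<Sum>i\<in>I. (of_real (c i) * cnj (g i x)) * g i y)"
      have F: "F \<in> L2_fun M"
        unfolding F_def using g by (rule L2_fun_lincomb)
      have "L2_inner M F F = (\<Sum>i\<in>I. (of_real (c i) * cnj (g i x)) * L2_inner M (g i) F)"
        by (subst F_def, subst L2_inner_lincomb_left[OF g F], assumption) simp
      also have "\<dots> = P x"
        unfolding P_def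
        by (intro sum.cong refl, subst F_def, subst L2_inner_lincomb_right[OF g g])
           (simp_all add: sum_distrib_left mult_ac)
      finally have 1: "(L2_norm M F)\<^sup>2 = Re (P x)"
        by (metis L2_inner_self Re_complex_of_real)
      have "L2_inner M F h = (\<Sum>i\<in>I. (of_real (c i) * cnj (g i x)) * L2_inner M (g i) h)"
        by (subst F_def, subst L2_inner_lincomb_left[OF g h], assumption) simp
      then have "u x * L2_inner M F h = S x"
        by (simp add: S_def sum_distrib_left mult_ac)
      then have 2: "Re (cnj (of_real t * cnj (u x)) * L2_inner M F h) = t * Re (S x)"
        by (simp add: mult.assoc)
      have "0 \<le> (L2_norm M (\<lambda>y. F y - (of_real t * cnj (u x)) * h y))\<^sup>2"
        by simp
      also have "\<dots> = R x"
        unfolding L2_norm_diff_sq[OF F h] 1 2 R_def by (simp add: norm_mult power_mult_distrib)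
      finally show ?thesis .
    qed
    then have "0 \<le> (\<integral>x. R x \<partial>M)"
      by simp
    also have "\<dots> = Re (\<integral>x. P x \<partial>M) - 2 * t * Re (\<integral>x. S x \<partial>M) + (t\<^sup>2 * (L2_norm M h)\<^sup>2) * (\<integral>x. (cmod (u x))\<^sup>2 \<partial>M)"
      unfolding R_def using int_P int_S L2_funD(2)[OF u] by simp
    also have "\<dots> = Q - 2 * t * (L2_norm M u)\<^sup>2 + t\<^sup>2 * ((L2_norm M u)\<^sup>2 * (L2_norm M h)\<^sup>2)"
      by (simp only: P S L2_norm_sq Re_complex_of_real) (simp add: mult_ac)
    finally show ?thesis .
  qed
  show Q_nonneg: "0 \<le> (\<Sum>i\<in>I. \<Sum>j\<in>I. c i * c j * (cmod (L2_inner M (g i) (g j)))\<^sup>2)"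
    using nonneg[of 0] by (simp add: Q_def)
  have "((L2_norm M u)\<^sup>2)\<^sup>2 \<le> Q * ((L2_norm M u)\<^sup>2 * (L2_norm M h)\<^sup>2)"
    using nonneg by (rule nonneg_quadratic_discriminant) auto
  then have "(L2_norm M u)\<^sup>2 * (L2_norm M u)\<^sup>2 \<le> (L2_norm M u)\<^sup>2 * (Q * (L2_norm M h)\<^sup>2)"
    by (simp add: power2_eq_square mult_ac)
  then have "(L2_norm M u)\<^sup>2 \<le> Q * (L2_norm M h)\<^sup>2"
    by (rule mult_self_le_imp_le) (use Q_nonneg in \<open>auto simp: Q_def\<close>)
  then show "(L2_norm M (\<lambda>x. \<Sum>i\<in>I. of_real (c i) * L2_inner M h (g i) * g i x))\<^sup>2
    \<le> (\<Sum>i\<in>I. \<Sum>j\<in>I. c i * c j * (cmod (L2_inner M (g i) (g j)))\<^sup>2) * (L2_norm M h)\<^sup>2"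
    by (simp only: u_def Q_def)
qed

section \<open>Completeness of \<open>L\<^sup>2\<close>\<close>

lemma (in prob_space) L2_fun_const: "(\<lambda>_. c) \<in> L2_fun M"
  by (simp add: L2_fun_def)

lemma (in prob_space) L2_fun_integrable:
  assumes "f \<in> L2_fun M"
  shows "integrable M f"
  using integrable_L2_mult[OF assms L2_fun_const[of 1]] by simp

text \<open>Cauchy-Schwarz against the constant 1, which has norm 1 for a probability
  measure.\<close>

lemma (in prob_space) L1_norm_le_L2_norm:
  assumes "f \<in> L2_fun M"
  shows "(\<integral>x. cmod (f x) \<partial>M) \<le> L2_norm M f"
proof -
  have *: "(\<lambda>x. of_real (cmod (f x))) \<in> L2_fun M"
    using L2_funD[OF assms] by (simp add: L2_fun_def)
  have "L2_inner M (\<lambda>x. of_real (cmod (f x))) (\<lambda>_. 1) = of_real (\<integral>x. cmod (f x) \<partial>M)"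
    by (simp add: L2_inner_def)
  then show ?thesis
    using L2_Cauchy_Schwarz[OF * L2_fun_const[of 1]] by (simp add: L2_norm_def prob_space)
qed

text \<open>A sequence that is Cauchy in \<open>L^2\<close> is Cauchy in \<open>L^1\<close>, so a
  subsequence converges almost everywhere. Fatou's lemma carries the Cauchy bound for
  \<open>f n - f (r i)\<close> over to \<open>f n - g\<close>.\<close>

lemma (in prob_space) L2_complete:
  fixes f :: "nat \<Rightarrow> 'a \<Rightarrow> complex"
  assumes f: "\<And>n. f n \<in> L2_fun M"
    and Cauchy: "\<And>e. e > 0 \<Longrightarrow> \<exists>N. \<forall>m\<ge>N. \<forall>n\<ge>N. L2_norm M (\<lambda>x. f m x - f n x) < e"
  obtains g where "g \<in> L2_fun M" "(\<lambda>n. L2_norm M (\<lambda>x. f n x - g x)) \<longlonglongrightarrow> 0"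
proof -
  have meas [measurable]: "f n \<in> borel_measurable M" for n
    using f by (rule L2_funD)
  have "\<exists>N. \<forall>i\<ge>N. \<forall>j\<ge>N. (\<integral>x. cmod (f i x - f j x) \<partial>M) < e" if "e > 0" for e
    using Cauchy[OF that] L1_norm_le_L2_norm[OF L2_fun_diff[OF f f]] by (meson le_less_trans)
  then obtain r where r: "strict_mono r" "AE x in M. Cauchy (\<lambda>i. f (r i) x)"
    using cauchy_L1_AE_cauchy_subseq[of M f] L2_fun_integrable[OF f] by blast
  define g where "g x = lim (\<lambda>i. f (r i) x)" for x
  have [measurable]: "g \<in> borel_measurable M"
    unfolding g_def by measurable
  have lim: "AE x in M. (\<lambda>i. f (r i) x) \<longlonglongrightarrow> g x"
    using r(2) unfolding g_def
    by eventually_elim (simp add: Cauchy_convergent_iff convergent_LIMSEQ_iff)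
  \<comment> \<open>The tolerance is left free because the claim is used twice: with tolerance 1 to
    see that \<open>g\<close> is square integrable, and with arbitrary tolerance for the
    convergence.\<close>
  have close: "(\<lambda>x. f n x - g x) \<in> L2_fun M \<and> L2_norm M (\<lambda>x. f n x - g x) \<le> e"
    if e: "e > 0" and N: "\<forall>m\<ge>N. \<forall>n\<ge>N. L2_norm M (\<lambda>x. f m x - f n x) < e" and n: "n \<ge> N" for e N n
  proof -
    let ?u = "\<lambda>i x. ennreal ((cmod (f n x - f (r i) x))\<^sup>2)"
    have "integral\<^sup>N M (?u i) \<le> ennreal (e\<^sup>2)" if "i \<ge> N" for i
    proof -
      have "integral\<^sup>N M (?u i) = ennreal ((L2_norm M (\<lambda>x. f n x - f (r i) x))\<^sup>2)"
        unfolding L2_norm_sq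
        by (intro nn_integral_eq_integral L2_funD(2) L2_fun_diff f) auto
      also have "r i \<ge> N"
        using that seq_suble[OF r(1), of i] by simp
      then have "(L2_norm M (\<lambda>x. f n x - f (r i) x))\<^sup>2 \<le> e\<^sup>2"
        using N n by (intro power_mono L2_norm_nonneg) (auto intro: less_imp_le)
      finally show ?thesis
        by (simp add: ennreal_leI)
    qed
    then have "limsup (\<lambda>i. integral\<^sup>N M (?u i)) \<le> ennreal (e\<^sup>2)"
      by (intro Limsup_bounded) (auto simp: eventually_sequentially)
    then have "liminf (\<lambda>i. integral\<^sup>N M (?u i)) \<le> ennreal (e\<^sup>2)"
      using Liminf_le_Limsup[of sequentially "\<lambda>i. integral\<^sup>N M (?u i)"] by simp
    moreover have "(\<integral>\<^sup>+ x. liminf (\<lambda>i. ?u i x) \<partial>M) \<le> liminf (\<lambda>i. integral\<^sup>N M (?u i))"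
      by (rule nn_integral_liminf) simp
    moreover have "(\<integral>\<^sup>+ x. liminf (\<lambda>i. ?u i x) \<partial>M) = (\<integral>\<^sup>+ x. ennreal ((cmod (f n x - g x))\<^sup>2) \<partial>M)"
    proof (rule nn_integral_cong_AE)
      show "AE x in M. liminf (\<lambda>i. ?u i x) = ennreal ((cmod (f n x - g x))\<^sup>2)"
        using lim
      proof eventually_elim
        case (elim x)
        show ?case
          by (rule lim_imp_Liminf) (auto intro!: tendsto_ennrealI tendsto_intros elim)
      qed
    qed
    ultimately have bound: "(\<integral>\<^sup>+ x. ennreal ((cmod (f n x - g x))\<^sup>2) \<partial>M) \<le> ennreal (e\<^sup>2)"
      by simp
    also have "\<dots> < \<infinity>"
      by simp
    finally have int: "integrable M (\<lambda>x. (cmod (f n x - g x))\<^sup>2)"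
      by (intro integrableI_bounded) auto
    have "(L2_norm M (\<lambda>x. f n x - g x))\<^sup>2 \<le> e\<^sup>2"
      using bound nn_integral_eq_integral[OF int] by (simp add: L2_norm_sq)
    then have "L2_norm M (\<lambda>x. f n x - g x) \<le> e"
      by (rule power2_le_imp_le) (use e in simp)
    with int show ?thesis
      by (simp add: L2_fun_def)
  qed
  obtain N where "\<forall>m\<ge>N. \<forall>n\<ge>N. L2_norm M (\<lambda>x. f m x - f n x) < 1"
    using Cauchy[of 1] by auto
  then have "(\<lambda>x. f N x - g x) \<in> L2_fun M"
    using close[of 1 N N] by simp
  then have g: "g \<in> L2_fun M"
    using L2_fun_diff[OF f[of N], of "\<lambda>x. f N x - g x"] by simp
  have "(\<lambda>n. L2_norm M (\<lambda>x. f n x - g x)) \<longlonglongrightarrow> 0"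
  proof (rule LIMSEQ_I)
    fix e :: real assume "e > 0"
    then obtain N where "\<forall>m\<ge>N. \<forall>n\<ge>N. L2_norm M (\<lambda>x. f m x - f n x) < e / 2"
      using Cauchy[of "e / 2"] by auto
    then have "L2_norm M (\<lambda>x. f n x - g x) < e" if "n \<ge> N" for n
      using close[of "e / 2" N n] that \<open>e > 0\<close> by auto
    then show "\<exists>N. \<forall>n\<ge>N. norm (L2_norm M (\<lambda>x. f n x - g x) - 0) < e"
      by (auto simp: L2_norm_nonneg)
  qed
  with g show ?thesis
    by (rule that)
qed

text \<open>Completeness is what turns total boundedness of an orbit into compactness of its
  closure.\<close>

lemma (in prob_space) mcomplete_L2: "Metric_space.mcomplete (L2_space M) (L2_dist M)"
  unfolding Metric_space.mcomplete_def[OF Metric_space_L2]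
proof (intro allI impI)
  interpret L2: Metric_space "L2_space M" "L2_dist M"
    by (rule Metric_space_L2)
  fix F assume F: "L2.MCauchy F"
  have "F n \<in> L2_class M ` L2_fun M" for n
    using F by (auto simp: L2.MCauchy_def simp flip: L2_space_def)
  then have "\<forall>n. \<exists>f. f \<in> L2_fun M \<and> F n = L2_class M f"
    by blast
  then obtain f where f: "f n \<in> L2_fun M" "F n = L2_class M (f n)" for n
    by metis
  obtain g where g: "g \<in> L2_fun M" "(\<lambda>n. L2_norm M (\<lambda>x. f n x - g x)) \<longlonglongrightarrow> 0"
  proof (rule L2_complete[of f])
    fix e :: real assume "e > 0"
    then obtain N where "\<forall>n n'. N \<le> n \<longrightarrow> N \<le> n' \<longrightarrow> L2_dist M (F n) (F n') < e"
      using F unfolding L2.MCauchy_def by blast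
    then show "\<exists>N. \<forall>m\<ge>N. \<forall>n\<ge>N. L2_norm M (\<lambda>x. f m x - f n x) < e"
      by (auto simp: f L2_dist_class)
  qed (use f in auto)
  have "limitin L2.mtopology F (L2_class M g) sequentially"
    unfolding L2.limitin_metric_dist_null
    using g by (simp add: f L2_dist_class L2_class_in_space)
  then show "\<exists>F'. limitin L2.mtopology F F' sequentially"
    by blast
qed

section \<open>Functions with precompact orbit along the strips\<close>

text \<open>The net may consist of arbitrary functions in \<open>L^2\<close>, not only of points of
  the orbit. It can then be pushed through Lipschitz maps and reused for limits.\<close>

definition precompact_orbit ::
  "'a measure \<Rightarrow> (int \<times> int \<Rightarrow> 'a \<Rightarrow> 'a) \<Rightarrow> real \<Rightarrow> ('a \<Rightarrow> complex) \<Rightarrow> bool" where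
  "precompact_orbit M T \<beta> f \<longleftrightarrow> (\<forall>b>0. \<forall>e>0. \<exists>N. finite N \<and> N \<subseteq> L2_fun M \<and>
     (\<forall>v \<in> strip \<beta> b. \<exists>g\<in>N. L2_norm M (\<lambda>x. koopman T v f x - g x) < e))"

lemma precompact_orbitD:
  assumes "precompact_orbit M T \<beta> f" "b > 0" "e > 0"
  obtains N where "finite N" "N \<subseteq> L2_fun M"
    "\<forall>v \<in> strip \<beta> b. \<exists>g\<in>N. L2_norm M (\<lambda>x. koopman T v f x - g x) < e"
proof -
  have "\<exists>N. finite N \<and> N \<subseteq> L2_fun M \<and>
      (\<forall>v \<in> strip \<beta> b. \<exists>g\<in>N. L2_norm M (\<lambda>x. koopman T v f x - g x) < e)"
    using assms by (simp add: precompact_orbit_def)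
  then show ?thesis
    by (elim exE conjE) (rule that)
qed

context Z2_mpds
begin

lemma space_eq_UNIV: "space M = UNIV"
  using sets_eq_imp_space_eq[OF sets_eq_borel] by simp

lemma L2_norm_koopman_diff:
  assumes "f \<in> L2_fun M" "g \<in> L2_fun M"
  shows "L2_norm M (\<lambda>x. koopman T v f x - koopman T v g x) = L2_norm M (\<lambda>x. f x - g x)"
  using L2_norm_koopman[OF L2_fun_diff[OF assms]] by (simp add: koopman_def comp_def)

lemma L2_inner_koopman:
  assumes f: "f \<in> L2_fun M" and g: "g \<in> L2_fun M"
  shows "L2_inner M (koopman T v f) (koopman T v g) = L2_inner M f g"
proof -
  have "(\<lambda>x. f x * cnj (g x)) \<in> borel_measurable M"
    using integrable_L2_mult[OF f g] by (rule borel_measurable_integrable)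
  then have "(\<integral>x. f x * cnj (g x) \<partial>distr M M (T v)) = (\<integral>x. f (T v x) * cnj (g (T v x)) \<partial>M)"
    by (intro integral_distr T_measurable)
  then show ?thesis
    by (simp add: L2_inner_def koopman_def T_invariant)
qed

text \<open>Total boundedness asks for centres inside the orbit. Each useful centre \<open>g\<close>
  of an \<open>e / 2\<close>-net is replaced by an orbit point near it, at time \<open>p g\<close>,
  which gives an \<open>e\<close>-net.\<close>

lemma precompact_orbit_imp_kronecker:
  assumes B: "B \<in> sets M" and pre: "precompact_orbit M T \<beta> (indicator B)"
  shows "B \<in> directional_kronecker M T \<beta>"
proof -
  interpret L2: Metric_space "L2_space M" "L2_dist M"
    by (rule Metric_space_L2)
  have UB: "koopman T v (indicator B) \<in> L2_fun M" for v
    by (intro koopman_L2_fun indicator_L2_fun B)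
  have "L2.mtotally_bounded ((\<lambda>v. L2_class M (koopman T v (indicator B))) ` strip \<beta> b)"
    if b: "b > 0" for b
    unfolding L2.mtotally_bounded_def
  proof (intro allI impI)
    fix e :: real assume e: "e > 0"
    obtain N where N: "finite N" "N \<subseteq> L2_fun M"
      "\<forall>v \<in> strip \<beta> b. \<exists>g\<in>N. L2_norm M (\<lambda>x. koopman T v (indicator B) x - g x) < e / 2"
      by (rule precompact_orbitD[OF pre b half_gt_zero[OF e]])
    let ?near = "\<lambda>g v. v \<in> strip \<beta> b \<and> L2_norm M (\<lambda>x. koopman T v (indicator B) x - g x) < e / 2"
    define p where "p g = (SOME v. ?near g v)" for g
    define K where "K = p ` {g \<in> N. \<exists>v. ?near g v}"
    have p: "?near g (p g)" if "?near g v" for g v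
      unfolding p_def by (rule someI[of "?near g" v]) (use that in simp)
    have K: "finite K" "K \<subseteq> strip \<beta> b"
      unfolding K_def using N(1) p by auto
    have "\<exists>w\<in>K. L2_dist M (L2_class M (koopman T w (indicator B)))
        (L2_class M (koopman T v (indicator B))) < e" if v: "v \<in> strip \<beta> b" for v
    proof -
      obtain g where g: "g \<in> N" "?near g v"
        using N(3) v by blast
      have "L2_norm M (\<lambda>x. koopman T (p g) (indicator B) x - koopman T v (indicator B) x) < e"
        using L2_norm_triangle_diff[OF UB[of "p g"] _ UB[of v], of g] g N(2) p[OF g(2)]
          L2_norm_minus_commute[of M g "koopman T v (indicator B)"] by auto
      moreover have "p g \<in> K"
        unfolding K_def using g by blast
      ultimately show ?thesis
        by (auto simp: L2_dist_class UB)
    qed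
    then show "\<exists>K. finite K \<and> K \<subseteq> (\<lambda>v. L2_class M (koopman T v (indicator B))) ` strip \<beta> b \<and>
        (\<lambda>v. L2_class M (koopman T v (indicator B))) ` strip \<beta> b \<subseteq> (\<Union>x\<in>K. L2.mball x e)"
      using K by (intro exI[of _ "(\<lambda>v. L2_class M (koopman T v (indicator B))) ` K"])
        (auto simp: L2.in_mball L2_class_in_space UB)
  qed
  then have "compactin L2.mtopology
      (L2.mtopology closure_of ((\<lambda>v. L2_class M (koopman T v (indicator B))) ` strip \<beta> b))"
    if "b > 0" for b
    using that by (simp only: L2.mtotally_bounded_eq_compact_closure_of[OF mcomplete_L2])
  then show ?thesis
    by (simp add: directional_kronecker_def L2_topology_def B)
qed

text \<open>The centres are orbit points, so that distances to them can be expressed through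
  autocorrelations at the differences \<open>v - w\<close>.\<close>

lemma kronecker_finite_net:
  assumes B: "B \<in> directional_kronecker M T \<beta>" and "b > 0" "e > 0"
  obtains F where "finite F" "F \<subseteq> strip \<beta> b"
    "\<And>v. v \<in> strip \<beta> b \<Longrightarrow>
       \<exists>w\<in>F. L2_norm M (\<lambda>x. koopman T v (indicator B) x - koopman T w (indicator B) x) < e"
proof -
  interpret L2: Metric_space "L2_space M" "L2_dist M"
    by (rule Metric_space_L2)
  have "B \<in> sets M"
    using B by (simp add: directional_kronecker_def)
  then have UB: "koopman T v (indicator B) \<in> L2_fun M" for v
    by (intro koopman_L2_fun indicator_L2_fun)
  let ?orb = "\<lambda>v. L2_class M (koopman T v (indicator B))"
  have "compactin L2.mtopology (L2.mtopology closure_of (?orb ` strip \<beta> b))"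
    using B \<open>b > 0\<close> by (simp add: directional_kronecker_def L2_topology_def)
  then have "L2.mtotally_bounded (?orb ` strip \<beta> b)"
    by (rule L2.compact_closure_of_imp_mtotally_bounded) (use L2_class_in_space[OF UB] in blast)
  then obtain K where K: "finite K" "K \<subseteq> ?orb ` strip \<beta> b"
      "?orb ` strip \<beta> b \<subseteq> (\<Union>x\<in>K. L2.mball x e)"
    using \<open>e > 0\<close> unfolding L2.mtotally_bounded_def by meson
  then obtain F where F: "F \<subseteq> strip \<beta> b" "finite F" "K = ?orb ` F"
    by (meson finite_subset_image)
  show ?thesis
  proof
    fix v assume "v \<in> strip \<beta> b"
    then have "?orb v \<in> (\<Union>x\<in>?orb ` F. L2.mball x e)"
      using K(3) F(3) by blast
    then obtain w where w: "w \<in> F" "L2_dist M (?orb w) (?orb v) < e"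
      by (auto simp: L2.in_mball)
    have "L2_dist M (?orb v) (?orb w) < e"
      unfolding L2.commute[of "?orb v"] by (rule w(2))
    then show "\<exists>w\<in>F. L2_norm M (\<lambda>x. koopman T v (indicator B) x - koopman T w (indicator B) x) < e"
      using w(1) by (simp only: L2_dist_class[OF UB UB]) blast
  qed (use F in auto)
qed

section \<open>Precompact orbits under Lipschitz maps and limits\<close>

lemma L2_fun_lipschitz:
  assumes f: "f \<in> L2_fun M" and L: "L-lipschitz_on UNIV (\<psi> :: complex \<Rightarrow> complex)"
  shows "(\<lambda>x. \<psi> (f x)) \<in> L2_fun M"
proof -
  have [measurable]: "f \<in> borel_measurable M" "\<psi> \<in> borel_measurable borel"
    using f lipschitz_on_continuous_on[OF L] by (auto dest: L2_funD intro: borel_measurable_continuous_onI)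
  \<comment> \<open>After subtracting \<open>\<psi> 0\<close> the function is dominated by
    \<open>L * |f|\<close>; the constant itself is square integrable because the measure is
    finite.\<close>
  have "(\<lambda>x. \<psi> (f x) - \<psi> 0) \<in> L2_fun M"
  proof (rule L2_fun_dominated)
    show "(\<lambda>x. of_real L * f x) \<in> L2_fun M"
      by (intro L2_fun_cmult f)
    show "cmod (\<psi> (f x) - \<psi> 0) \<le> cmod (of_real L * f x)" for x
      using lipschitz_onD[OF L, of "f x" 0] lipschitz_on_nonneg[OF L] by (simp add: dist_norm norm_mult)
  qed simp
  from L2_fun_add[OF this L2_fun_const[of "\<psi> 0"]] show ?thesis
    by simp
qed

text \<open>Composition with \<open>\<psi>\<close> commutes with the Koopman operators and maps a
  net of mesh \<open>e / (L + 1)\<close> to one of mesh below \<open>e\<close>. The summand 1 covers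
  \<open>L = 0\<close>.\<close>

lemma precompact_orbit_lipschitz:
  assumes f: "f \<in> L2_fun M" and pre: "precompact_orbit M T \<beta> f"
    and L: "L-lipschitz_on UNIV (\<psi> :: complex \<Rightarrow> complex)"
  shows "precompact_orbit M T \<beta> (\<lambda>x. \<psi> (f x))"
  unfolding precompact_orbit_def
proof (intro allI impI)
  fix b e :: real assume "b > 0" "e > 0"
  have L0: "L \<ge> 0"
    using L by (rule lipschitz_on_nonneg)
  obtain N where N: "finite N" "N \<subseteq> L2_fun M"
      "\<forall>v \<in> strip \<beta> b. \<exists>g\<in>N. L2_norm M (\<lambda>x. koopman T v f x - g x) < e / (L + 1)"
    by (rule precompact_orbitD[OF pre \<open>b > 0\<close>, of "e / (L + 1)"]) (use \<open>e > 0\<close> L0 in auto)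
  have "L2_norm M (\<lambda>x. koopman T v (\<lambda>x. \<psi> (f x)) x - \<psi> (g x)) < e"
    if g: "g \<in> N" "L2_norm M (\<lambda>x. koopman T v f x - g x) < e / (L + 1)" for v g
  proof -
    have g': "g \<in> L2_fun M"
      using g N by auto
    have D: "(\<lambda>x. koopman T v f x - g x) \<in> L2_fun M"
      by (intro L2_fun_diff koopman_L2_fun f g')
    have "(\<lambda>x. \<psi> (koopman T v f x) - \<psi> (g x)) \<in> L2_fun M"
      by (intro L2_fun_diff L2_fun_lipschitz[OF _ L] koopman_L2_fun f g')
    then have "L2_norm M (\<lambda>x. \<psi> (koopman T v f x) - \<psi> (g x))
        \<le> L2_norm M (\<lambda>x. of_real L * (koopman T v f x - g x))"
    proof (intro L2_norm_mono L2_fun_cmult D)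
      show "cmod (\<psi> (koopman T v f x) - \<psi> (g x)) \<le> cmod (of_real L * (koopman T v f x - g x))" for x
        using lipschitz_onD[OF L, of "koopman T v f x" "g x"] L0 by (simp add: dist_norm norm_mult)
    qed (auto dest: L2_funD)
    also have "\<dots> = L * L2_norm M (\<lambda>x. koopman T v f x - g x)"
      using L0 by (simp add: L2_norm_cmult)
    also have "\<dots> \<le> L * (e / (L + 1))"
      using g(2) L0 by (intro mult_left_mono) auto
    also have "\<dots> < e"
      using L0 \<open>e > 0\<close> by (simp add: field_simps)
    finally show ?thesis
      by (simp add: koopman_def)
  qed
  then have "\<forall>v \<in> strip \<beta> b. \<exists>g \<in> (\<lambda>g x. \<psi> (g x)) ` N.
      L2_norm M (\<lambda>x. koopman T v (\<lambda>x. \<psi> (f x)) x - g x) < e"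
    using N(3) by fast
  moreover have "(\<lambda>g x. \<psi> (g x)) ` N \<subseteq> L2_fun M"
    using N(2) L2_fun_lipschitz[OF _ L] by blast
  ultimately show "\<exists>N. finite N \<and> N \<subseteq> L2_fun M \<and> (\<forall>v \<in> strip \<beta> b. \<exists>g\<in>N.
      L2_norm M (\<lambda>x. koopman T v (\<lambda>x. \<psi> (f x)) x - g x) < e)"
    using N(1) by blast
qed

text \<open>The Koopman operators are isometries, so one \<open>f n\<close> within
  \<open>e / 2\<close> of \<open>g\<close> stays that close along the whole orbit, and its net
  serves \<open>g\<close> too.\<close>

lemma precompact_orbit_limit:
  assumes f: "\<And>n. f n \<in> L2_fun M" and g: "g \<in> L2_fun M"
    and lim: "(\<lambda>n. L2_norm M (\<lambda>x. f n x - g x)) \<longlonglongrightarrow> 0"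
    and pre: "\<And>n. precompact_orbit M T \<beta> (f n)"
  shows "precompact_orbit M T \<beta> g"
  unfolding precompact_orbit_def
proof (intro allI impI)
  fix b e :: real assume "b > 0" "e > 0"
  then have "\<forall>\<^sub>F n in sequentially. L2_norm M (\<lambda>x. f n x - g x) < e / 2"
    by (intro order_tendstoD(2)[OF lim]) simp
  then obtain n where n: "L2_norm M (\<lambda>x. f n x - g x) < e / 2"
    using eventually_happens'[OF sequentially_bot] by blast
  obtain N where N: "finite N" "N \<subseteq> L2_fun M"
      "\<forall>v \<in> strip \<beta> b. \<exists>h\<in>N. L2_norm M (\<lambda>x. koopman T v (f n) x - h x) < e / 2"
    by (rule precompact_orbitD[OF pre[of n] \<open>b > 0\<close> half_gt_zero[OF \<open>e > 0\<close>]])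
  have "L2_norm M (\<lambda>x. koopman T v g x - h x) < e"
    if "h \<in> N" "L2_norm M (\<lambda>x. koopman T v (f n) x - h x) < e / 2" for v h
    using L2_norm_triangle_diff[OF koopman_L2_fun[OF g, of v] koopman_L2_fun[OF f[of n], of v], of h]
      L2_norm_koopman_diff[OF g f[of n], of v] L2_norm_minus_commute[of M g "f n"] that n N(2)
    by auto
  with N(3) have "\<forall>v \<in> strip \<beta> b. \<exists>h\<in>N. L2_norm M (\<lambda>x. koopman T v g x - h x) < e"
    by meson
  with N(1,2) show "\<exists>N. finite N \<and> N \<subseteq> L2_fun M \<and>
      (\<forall>v \<in> strip \<beta> b. \<exists>h\<in>N. L2_norm M (\<lambda>x. koopman T v g x - h x) < e)"
    by blast
qed

text \<open>The indicator is the pointwise limit of the ramps \<open>\<psi> n\<close>, which are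
  Lipschitz with constant \<open>n\<close>. Dominated convergence makes this a limit in
  \<open>L^2\<close>.\<close>

lemma precompact_orbit_indicator_pos:
  assumes f: "f \<in> L2_fun M" and pre: "precompact_orbit M T \<beta> f"
    and l: "1-lipschitz_on UNIV (l :: complex \<Rightarrow> real)"
  shows "precompact_orbit M T \<beta> (indicator {x. 0 < l (f x)})"
proof -
  define \<psi> where "\<psi> n z = complex_of_real (min 1 (max 0 (real n * l z)))" for n z
  have clamp: "\<bar>min 1 (max 0 s) - min 1 (max 0 t)\<bar> \<le> \<bar>s - t\<bar>" for s t :: real
    by (auto simp: min_def max_def)
  have L: "(real n)-lipschitz_on UNIV (\<psi> n)" for n
  proof (rule lipschitz_onI)
    fix y z
    have "dist (\<psi> n y) (\<psi> n z) \<le> \<bar>real n * l y - real n * l z\<bar>"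
      unfolding \<psi>_def dist_of_real using clamp by (simp add: dist_real_def)
    also have "\<dots> \<le> real n * \<bar>l y - l z\<bar>"
      by (simp add: abs_mult flip: right_diff_distrib)
    also have "\<dots> \<le> real n * dist y z"
      using lipschitz_onD[OF l, of y z] by (intro mult_left_mono) (auto simp: dist_real_def)
    finally show "dist (\<psi> n y) (\<psi> n z) \<le> real n * dist y z" .
  qed simp
  have [measurable]: "f \<in> borel_measurable M" "l \<in> borel_measurable borel"
    using f lipschitz_on_continuous_on[OF l] by (auto dest: L2_funD intro: borel_measurable_continuous_onI)
  let ?B = "{x. 0 < l (f x)}"
  have B [measurable]: "?B \<in> sets M"
    using measurable_sets[of "\<lambda>x. l (f x)" M borel "{0<..}"] by (auto simp: vimage_def space_eq_UNIV)
  have \<psi>f: "(\<lambda>x. \<psi> n (f x)) \<in> L2_fun M" for n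
    by (rule L2_fun_lipschitz[OF f L])
  have [measurable]: "(\<lambda>x. \<psi> n (f x)) \<in> borel_measurable M" for n
    by (rule L2_funD[OF \<psi>f])
  have ptw: "(\<lambda>n. \<psi> n z) \<longlonglongrightarrow> indicator {z. 0 < l z} z" for z
  proof (cases "0 < l z")
    case True
    obtain N where N: "1 < real N * l z"
      using reals_Archimedean3[OF True] by blast
    have "\<psi> n z = 1" if "n \<ge> N" for n
    proof -
      have "real N * l z \<le> real n * l z"
        using that True by (intro mult_right_mono) auto
      then show ?thesis
        using N by (simp add: \<psi>_def)
    qed
    then have "\<forall>\<^sub>F n in sequentially. \<psi> n z = indicator {z. 0 < l z} z"
      using True by (auto simp: eventually_sequentially)
    then show ?thesis
      by (rule tendsto_eventually)
  next
    case False
    then have "max 0 (real n * l z) = 0" for n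
      by (intro max_absorb1 mult_nonneg_nonpos) auto
    then have "\<psi> n z = indicator {z. 0 < l z} z" for n
      using False by (simp add: \<psi>_def)
    then show ?thesis
      by simp
  qed
  have "(\<lambda>n. \<integral>x. (cmod (\<psi> n (f x) - indicator ?B x))\<^sup>2 \<partial>M) \<longlonglongrightarrow> (\<integral>x. 0 \<partial>M)"
  proof (rule integral_dominated_convergence[where w = "\<lambda>_. 1"])
    have "(\<lambda>n. (cmod (\<psi> n (f x) - indicator ?B x))\<^sup>2) \<longlonglongrightarrow> (cmod (indicator ?B x - indicator ?B x))\<^sup>2" for x
      using ptw[of "f x"] by (intro tendsto_intros) (simp add: indicator_def)
    then show "AE x in M. (\<lambda>n. (cmod (\<psi> n (f x) - indicator ?B x))\<^sup>2) \<longlonglongrightarrow> 0"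
      by simp
    have "cmod (\<psi> n (f x) - indicator ?B x) \<le> 1" for n x
    proof -
      have "\<psi> n (f x) - indicator ?B x
          = complex_of_real (min 1 (max 0 (real n * l (f x))) - indicator ?B x)"
        by (simp add: \<psi>_def indicator_def)
      then show ?thesis
        by (simp only: norm_of_real) (auto simp: indicator_def)
    qed
    then show "AE x in M. norm ((cmod (\<psi> n (f x) - indicator ?B x))\<^sup>2) \<le> 1" for n
      by (simp add: power_le_one)
  qed auto
  then have "(\<lambda>n. L2_norm M (\<lambda>x. \<psi> n (f x) - indicator ?B x)) \<longlonglongrightarrow> 0"
    unfolding L2_norm_def by (drule_tac tendsto_real_sqrt) simp
  then show ?thesis
    by (rule precompact_orbit_limit[OF \<psi>f indicator_L2_fun[OF B]])
       (rule precompact_orbit_lipschitz[OF f pre L])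
qed

text \<open>For \<open>l = Re\<close> and \<open>l = Im\<close> the set where
  \<open>l (f x) > 0\<close> lies in the Kronecker algebra, so it is null or of full measure. Either
  way \<open>l (f x)\<close> has a constant sign almost everywhere, and its integral is 0.\<close>

lemma weakly_mixing_precompact_imp_AE_0:
  assumes wm: "directional_weakly_mixing M T \<beta>"
    and f: "f \<in> L2_fun M" and pre: "precompact_orbit M T \<beta> f" and mean: "(\<integral>x. f x \<partial>M) = 0"
  shows "AE x in M. f x = 0"
proof -
  have *: "AE x in M. l (f x) = 0"
    if l: "1-lipschitz_on UNIV (l :: complex \<Rightarrow> real)" and int: "integrable M (\<lambda>x. l (f x))"
      and int0: "(\<integral>x. l (f x) \<partial>M) = 0" for l
  proof -
    let ?B = "{x. 0 < l (f x)}"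
    have [measurable]: "(\<lambda>x. l (f x)) \<in> borel_measurable M"
      using int by (rule borel_measurable_integrable)
    have B: "?B \<in> sets M"
      using measurable_sets[of "\<lambda>x. l (f x)" M borel "{0<..}"] by (auto simp: vimage_def space_eq_UNIV)
    have "?B \<in> directional_kronecker M T \<beta>"
      by (intro precompact_orbit_imp_kronecker B precompact_orbit_indicator_pos f pre l)
    then have "prob ?B \<in> {0, 1}"
      using wm unfolding directional_weakly_mixing_def by (rule bspec[rotated])
    then consider "prob ?B = 0" | "prob ?B = 1"
      by auto
    then show ?thesis
    proof cases
      case 1
      then have neg: "AE x in M. 0 \<le> - l (f x)"
        using prob_eq_0[OF B] by auto
      have "integrable M (\<lambda>x. - l (f x))" "(\<integral>x. - l (f x) \<partial>M) = 0"
        using int int0 by auto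
      then show ?thesis
        using integral_nonneg_eq_0_iff_AE[of M "\<lambda>x. - l (f x)"] neg by auto
    next
      case 2
      then have "AE x in M. 0 < l (f x)"
        using prob_eq_1[OF B] by auto
      then have "AE x in M. 0 \<le> l (f x)"
        by eventually_elim simp
      then show ?thesis
        using integral_nonneg_eq_0_iff_AE[OF int] int0 by simp
    qed
  qed
  have int: "integrable M f"
    using f by (rule L2_fun_integrable)
  have "AE x in M. Re (f x) = 0"
  proof (rule *)
    show "1-lipschitz_on UNIV Re"
    proof (rule lipschitz_onI)
      show "dist (Re y) (Re z) \<le> 1 * dist y z" for y z
        using abs_Re_le_cmod[of "y - z"] by (simp add: dist_norm)
    qed simp
  qed (use int mean in simp_all)
  moreover have "AE x in M. Im (f x) = 0"
  proof (rule *)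
    show "1-lipschitz_on UNIV Im"
    proof (rule lipschitz_onI)
      show "dist (Im y) (Im z) \<le> 1 * dist y z" for y z
        using abs_Im_le_cmod[of "y - z"] by (simp add: dist_norm)
    qed simp
  qed (use int mean in simp_all)
  ultimately show ?thesis
    by eventually_elim (simp add: complex_eq_iff)
qed

end

section \<open>Counting in strips\<close>

text \<open>Signed vertical distance from the line of slope \<open>\<beta>\<close>. It is additive,
  so differences of points of a strip lie in the strip of twice the width.\<close>

definition strip_offset :: "real \<Rightarrow> int \<times> int \<Rightarrow> real" where
  "strip_offset \<beta> v = of_int (snd v) - \<beta> * of_int (fst v)"

lemma strip_eq_offset: "strip \<beta> b = {v. \<bar>strip_offset \<beta> v\<bar> \<le> b}"
  by (auto simp: strip_def strip_offset_def abs_le_iff algebra_simps)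

lemma strip_offset_diff: "strip_offset \<beta> (v - w) = strip_offset \<beta> v - strip_offset \<beta> w"
  by (simp add: strip_offset_def algebra_simps)

text \<open>Each column meets the strip in an integer interval with at most \<open>2 * b + 1\<close>
  points.\<close>

lemma strip_window:
  assumes "finite A" "b \<ge> 0"
  shows "finite (strip \<beta> b \<inter> (A \<times> UNIV))"
    and "real (card (strip \<beta> b \<inter> (A \<times> UNIV))) \<le> (2 * b + 1) * real (card A)"
proof -
  let ?I = "\<lambda>m. {\<lceil>\<beta> * of_int m - b\<rceil>..\<lfloor>\<beta> * of_int m + b\<rfloor>}"
  have eq: "strip \<beta> b \<inter> (A \<times> UNIV) = Sigma A ?I"
    by (auto simp: strip_def ceiling_le_iff le_floor_iff)
  show "finite (strip \<beta> b \<inter> (A \<times> UNIV))"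
    unfolding eq using assms(1) by simp
  have "real (card (?I m)) \<le> 2 * b + 1" for m
  proof (cases "\<lceil>\<beta> * of_int m - b\<rceil> \<le> \<lfloor>\<beta> * of_int m + b\<rfloor> + 1")
    case True
    then have "real (card (?I m)) = of_int (\<lfloor>\<beta> * of_int m + b\<rfloor> + 1 - \<lceil>\<beta> * of_int m - b\<rceil>)"
      by simp
    then show ?thesis
      by linarith
  qed (use assms(2) in auto)
  then have "(\<Sum>m\<in>A. real (card (?I m))) \<le> (\<Sum>m\<in>A. 2 * b + 1)"
    by (rule sum_mono)
  then show "real (card (strip \<beta> b \<inter> (A \<times> UNIV))) \<le> (2 * b + 1) * real (card A)"
    unfolding eq using assms(1) by (simp add: card_SigmaI mult.commute)
qed

lemma strip_upto_eq: "strip_upto \<beta> b k = strip \<beta> b \<inter> ({0..<int k} \<times> UNIV)"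
  unfolding strip_upto_def by (auto simp: atLeastLessThanPlusOne_atLeastAtMost_int[symmetric])

lemma finite_strip_upto: "b \<ge> 0 \<Longrightarrow> finite (strip_upto \<beta> b k)"
  and card_strip_upto_le: "b \<ge> 0 \<Longrightarrow> real (card (strip_upto \<beta> b k)) \<le> (2 * b + 1) * real k"
  unfolding strip_upto_eq using strip_window[of "{0..<int k}" b \<beta>] by auto

text \<open>The enlargement adds at most \<open>2 * R\<close> columns, with at most
  \<open>2 * b + 1\<close> points each and values at most \<open>C\<close>. What matters is that
  this error does not depend on \<open>k\<close>.\<close>

lemma sum_strip_enlarged_le:
  fixes a :: "int \<times> int \<Rightarrow> real"
  assumes a: "\<And>v. 0 \<le> a v" "\<And>v. a v \<le> C" and b: "b \<ge> 0"
  shows "(\<Sum>v \<in> strip \<beta> b \<inter> ({-int R..<int k + int R} \<times> UNIV). a v)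
    \<le> (\<Sum>v \<in> strip_upto \<beta> b k. a v) + C * ((2 * b + 1) * real (2 * R))"
proof -
  define A where "A = {-int R..<0} \<union> {int k..<int k + int R}"
  have A: "finite A" "card A \<le> 2 * R"
    unfolding A_def using card_Un_le[of "{-int R..<0}" "{int k..<int k + int R}"] by auto
  have C: "C \<ge> 0"
    using a order_trans by blast
  have "(\<Sum>v \<in> strip \<beta> b \<inter> ({-int R..<int k + int R} \<times> UNIV). a v)
      \<le> (\<Sum>v \<in> strip_upto \<beta> b k \<union> strip \<beta> b \<inter> (A \<times> UNIV). a v)"
  proof (rule sum_mono2)
    show "strip \<beta> b \<inter> ({-int R..<int k + int R} \<times> UNIV) \<subseteq> strip_upto \<beta> b k \<union> strip \<beta> b \<inter> (A \<times> UNIV)"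
      unfolding strip_upto_eq A_def by auto
  qed (use a A b finite_strip_upto strip_window in auto)
  also have "\<dots> \<le> (\<Sum>v \<in> strip_upto \<beta> b k. a v) + (\<Sum>v \<in> strip \<beta> b \<inter> (A \<times> UNIV). a v)"
    using sum_Un[OF finite_strip_upto[OF b] strip_window(1)[OF A(1) b], of a]
      sum_nonneg[of "strip_upto \<beta> b k \<inter> (strip \<beta> b \<inter> (A \<times> UNIV))" a] a(1) by simp
  also have "(\<Sum>v \<in> strip \<beta> b \<inter> (A \<times> UNIV). a v) \<le> real (card (strip \<beta> b \<inter> (A \<times> UNIV))) * C"
    using a by (intro sum_bounded_above) auto
  also have "\<dots> \<le> ((2 * b + 1) * real (card A)) * C"
    using strip_window[OF A(1) b] C by (intro mult_right_mono) auto
  also have "\<dots> \<le> ((2 * b + 1) * real (2 * R)) * C"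
    using A(2) b C by (intro mult_right_mono mult_left_mono) auto
  finally show ?thesis
    by (simp add: mult_ac)
qed

section \<open>Double counting of translates and growth of the strip counts\<close>

lemma strip_upto_translate_subset:
  assumes F: "finite F"
  obtains R where "\<And>k v w. v \<in> strip_upto \<beta> b' k \<Longrightarrow> w \<in> F \<Longrightarrow> v - w \<in> strip \<beta> b \<Longrightarrow>
    v - w \<in> strip \<beta> b \<inter> ({-int R..<int k + int R} \<times> UNIV)"
proof
  \<comment> \<open>The sum of the horizontal displacements bounds each of them, also for empty
    \<open>F\<close>.\<close>
  define R where "R = nat (\<Sum>w\<in>F. \<bar>fst w\<bar>)"
  fix k v w assume *: "v \<in> strip_upto \<beta> b' k" "w \<in> F" "v - w \<in> strip \<beta> b"
  have "\<bar>fst w\<bar> \<le> int R"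
    unfolding R_def using member_le_sum[of w F "\<lambda>w. \<bar>fst w\<bar>"] * F by (simp add: sum_nonneg)
  then show "v - w \<in> strip \<beta> b \<inter> ({-int R..<int k + int R} \<times> UNIV)"
    using * unfolding strip_upto_eq by (cases v; cases w) auto
qed

text \<open>Double counting: every \<open>v\<close> is charged to a translate \<open>v - w\<close>
  at which \<open>a\<close> is at least \<open>c\<close>. For fixed \<open>w\<close> the map from
  \<open>v\<close> to \<open>v - w\<close> is injective, so each \<open>w\<close> receives at most
  the sum over the enlarged window. With \<open>a = 1\<close> this compares strips of different
  widths; with autocorrelations it shows that large values have positive density.\<close>

lemma sum_strip_translates_le:
  fixes a :: "int \<times> int \<Rightarrow> real"
  assumes F: "finite F" and a: "\<And>v. 0 \<le> a v" "\<And>v. a v \<le> C" and b: "b \<ge> 0"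
    and big: "\<And>v. v \<in> strip \<beta> b' \<Longrightarrow> \<exists>w\<in>F. v - w \<in> strip \<beta> b \<and> c \<le> a (v - w)"
  obtains E where "\<And>k. c * real (card (strip_upto \<beta> b' k)) \<le> real (card F) * ((\<Sum>v \<in> strip_upto \<beta> b k. a v) + E)"
proof -
  obtain R where R: "\<And>k v w. v \<in> strip_upto \<beta> b' k \<Longrightarrow> w \<in> F \<Longrightarrow> v - w \<in> strip \<beta> b \<Longrightarrow>
      v - w \<in> strip \<beta> b \<inter> ({-int R..<int k + int R} \<times> UNIV)"
    using strip_upto_translate_subset[OF F] by blast
  show ?thesis
  proof
    fix k
    let ?W = "strip \<beta> b \<inter> ({-int R..<int k + int R} \<times> UNIV)"
    have W: "finite ?W"
      using strip_window[of "{-int R..<int k + int R}" b \<beta>] b by simp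
    have fin: "finite (strip_upto \<beta> b' k)"
    proof (rule finite_subset)
      show "strip_upto \<beta> b' k \<subseteq> (\<Union>w\<in>F. (\<lambda>u. u + w) ` ?W)"
      proof
        fix v assume v: "v \<in> strip_upto \<beta> b' k"
        then have "v \<in> strip \<beta> b'"
          by (simp add: strip_upto_def)
        then obtain w where w: "w \<in> F" "v - w \<in> strip \<beta> b"
          using big by blast
        have "v = (v - w) + w"
          by simp
        then show "v \<in> (\<Union>w\<in>F. (\<lambda>u. u + w) ` ?W)"
          by (intro UN_I[OF w(1)] image_eqI[OF _ R[OF v w]])
      qed
    qed (intro finite_UN_I finite_imageI F W)
    have "(\<Sum>v \<in> strip_upto \<beta> b' k. c) \<le> (\<Sum>v \<in> strip_upto \<beta> b' k. \<Sum>w\<in>F. if v - w \<in> ?W then a (v - w) else 0)"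
    proof (rule sum_mono)
      fix v assume v: "v \<in> strip_upto \<beta> b' k"
      then have "v \<in> strip \<beta> b'"
        by (simp add: strip_upto_def)
      then obtain w where w: "w \<in> F" "v - w \<in> strip \<beta> b" "c \<le> a (v - w)"
        using big by blast
      have "c \<le> (if v - w \<in> ?W then a (v - w) else 0)"
        using w(3) by (simp only: R[OF v w(1,2)] if_True)
      also have "\<dots> \<le> (\<Sum>w\<in>F. if v - w \<in> ?W then a (v - w) else 0)"
        using w(1) F a(1) by (intro member_le_sum) simp_all
      finally show "c \<le> (\<Sum>w\<in>F. if v - w \<in> ?W then a (v - w) else 0)" .
    qed
    also have "\<dots> = (\<Sum>w\<in>F. \<Sum>v \<in> strip_upto \<beta> b' k. if v - w \<in> ?W then a (v - w) else 0)"
      by (rule sum.swap)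
    also have "\<dots> \<le> (\<Sum>w\<in>F. \<Sum>v \<in> ?W. a v)"
    proof (rule sum_mono)
      fix w
      have "(\<Sum>v \<in> strip_upto \<beta> b' k. if v - w \<in> ?W then a (v - w) else 0)
          = (\<Sum>v \<in> {v \<in> strip_upto \<beta> b' k. v - w \<in> ?W}. a (v - w))"
        using fin by (simp add: sum.inter_filter)
      also have "\<dots> = (\<Sum>v \<in> (\<lambda>v. v - w) ` {v \<in> strip_upto \<beta> b' k. v - w \<in> ?W}. a v)"
        by (subst sum.reindex) (simp_all add: inj_on_def)
      also have "\<dots> \<le> (\<Sum>v \<in> ?W. a v)"
        by (intro sum_mono2 W a(1)) blast
      finally show "(\<Sum>v \<in> strip_upto \<beta> b' k. if v - w \<in> ?W then a (v - w) else 0) \<le> (\<Sum>v \<in> ?W. a v)" .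
    qed
    also have "\<dots> = real (card F) * (\<Sum>v \<in> ?W. a v)"
      by simp
    also have "\<dots> \<le> real (card F) * ((\<Sum>v \<in> strip_upto \<beta> b k. a v) + C * ((2 * b + 1) * real (2 * R)))"
      using sum_strip_enlarged_le[OF a b] by (intro mult_left_mono) auto
    finally show "c * real (card (strip_upto \<beta> b' k))
        \<le> real (card F) * ((\<Sum>v \<in> strip_upto \<beta> b k. a v) + C * ((2 * b + 1) * real (2 * R)))"
      by (simp add: mult.commute)
  qed
qed

lemma card_strip_upto_compare:
  assumes "b > 0"
  obtains D E where "D > 0" "\<And>k. real (card (strip_upto \<beta> b' k)) \<le> D * (real (card (strip_upto \<beta> b k)) + E)"
proof -
  obtain F where F: "finite F" "\<And>v. v \<in> strip \<beta> b' \<Longrightarrow> \<exists>w\<in>F. v - w \<in> strip \<beta> b"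
    using strip_cover[OF assms] by blast
  obtain E where E: "\<And>k. 1 * real (card (strip_upto \<beta> b' k))
      \<le> real (card F) * ((\<Sum>v \<in> strip_upto \<beta> b k. 1) + E)"
    using sum_strip_translates_le[OF F(1), of "\<lambda>_. 1" 1 b \<beta> b' 1] F(2) assms by auto
  \<comment> \<open>The factor \<open>card F + 1\<close> is positive even if \<open>F\<close> is
    empty. Replacing \<open>E\<close> by \<open>max 0 E\<close> makes the other factor nonnegative,
    so that raising the first one is harmless.\<close>
  have "real (card (strip_upto \<beta> b' k)) \<le> (real (card F) + 1) * (real (card (strip_upto \<beta> b k)) + max 0 E)" for k
  proof -
    have "real (card (strip_upto \<beta> b' k)) \<le> real (card F) * (real (card (strip_upto \<beta> b k)) + E)"
      using E[of k] by simp
    also have "\<dots> \<le> real (card F) * (real (card (strip_upto \<beta> b k)) + max 0 E)"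
      by (intro mult_left_mono) auto
    also have "\<dots> \<le> (real (card F) + 1) * (real (card (strip_upto \<beta> b k)) + max 0 E)"
      by (intro mult_right_mono) auto
    finally show ?thesis .
  qed
  then show ?thesis
    by (rule that[rotated]) simp
qed

text \<open>A strip of half-width 1 contains the point with second coordinate
  floor(\<open>\<beta> m\<close>) in every column \<open>m\<close>. A thin strip may miss columns,
  so its count is compared with this one.\<close>

lemma card_strip_upto_ge:
  assumes "b > 0"
  obtains D E where "D > 0" "\<And>k. real k \<le> D * (real (card (strip_upto \<beta> b k)) + E)"
proof -
  obtain D E where D: "D > 0" "\<And>k. real (card (strip_upto \<beta> 1 k)) \<le> D * (real (card (strip_upto \<beta> b k)) + E)"
    using card_strip_upto_compare[OF assms] by blast
  have "k \<le> card (strip_upto \<beta> 1 k)" for k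
  proof -
    have "(\<lambda>m. (m, \<lfloor>\<beta> * of_int m\<rfloor>)) ` {0..<int k} \<subseteq> strip_upto \<beta> 1 k"
      unfolding strip_upto_eq strip_def by auto linarith+
    then have "card ((\<lambda>m. (m, \<lfloor>\<beta> * of_int m\<rfloor>)) ` {0..<int k}) \<le> card (strip_upto \<beta> 1 k)"
      by (intro card_mono finite_strip_upto) simp
    then show ?thesis
      by (simp add: card_image inj_on_def)
  qed
  then have "real k \<le> D * (real (card (strip_upto \<beta> b k)) + E)" for k
    using D(2)[of k] by (meson of_nat_mono order_trans)
  with D(1) show ?thesis
    by (rule that)
qed

lemma filterlim_card_strip_upto:
  assumes "b > 0"
  shows "filterlim (\<lambda>k. real (card (strip_upto \<beta> b k))) at_top sequentially"
proof -
  obtain D E where D: "D > 0" "\<And>k. real k \<le> D * (real (card (strip_upto \<beta> b k)) + E)"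
    using card_strip_upto_ge[OF assms] by blast
  have "real k / D - E \<le> real (card (strip_upto \<beta> b k))" for k
    using D(2)[of k] D(1) by (simp add: field_simps)
  moreover have "filterlim (\<lambda>k. real k / D - E) at_top sequentially"
    using D(1) by real_asymp
  ultimately show ?thesis
    by (auto intro: filterlim_at_top_mono)
qed

section \<open>Decay of autocorrelations implies weak mixing\<close>

context Z2_mpds
begin

lemma L2_inner_koopman_diff:
  assumes f: "f \<in> L2_fun M" and g: "g \<in> L2_fun M"
  shows "L2_inner M (koopman T (v - w) f) g = L2_inner M (koopman T v f) (koopman T w g)"
  using L2_inner_koopman[OF koopman_L2_fun[OF f, of "v - w"] g, of w] koopman_add[of "v - w" w f]
  by simp

lemma autocorrelation_decay_imp_weakly_mixing:
  assumes b: "b > 0"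
    and decay: "\<And>f. f \<in> L2_fun M \<Longrightarrow>
      (\<lambda>k. (\<Sum>v \<in> strip_upto \<beta> b k.
              cmod (L2_inner M (koopman T v f) f - L2_inner M f (\<lambda>_. 1) * L2_inner M (\<lambda>_. 1) f))
           / real (card (strip_upto \<beta> b k))) \<longlonglongrightarrow> 0"
  shows "directional_weakly_mixing M T \<beta>"
  unfolding directional_weakly_mixing_def
proof
  fix B assume kron: "B \<in> directional_kronecker M T \<beta>"
  then have B: "B \<in> sets M"
    by (simp add: directional_kronecker_def)
  let ?I = "indicator B :: 'a \<Rightarrow> complex"
  define f where "f = (\<lambda>x. ?I x - of_real (prob B))"
  have f: "f \<in> L2_fun M"
    unfolding f_def by (intro L2_fun_diff indicator_L2_fun B L2_fun_const)
  have "(\<integral>x. complex_of_real (indicat_real B x) \<partial>M) = of_real (prob B)"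
    using B by simp
  then have "(\<integral>x. ?I x \<partial>M) = of_real (prob B)"
    by (simp only: of_real_indicator)
  moreover have "integrable M ?I"
    by (intro L2_fun_integrable indicator_L2_fun B)
  ultimately have mean: "L2_inner M f (\<lambda>_. 1) = 0"
    by (simp add: L2_inner_def f_def prob_space)
  have "L2_norm M f = 0"
  proof (rule ccontr)
    assume "L2_norm M f \<noteq> 0"
    then have pos: "L2_norm M f > 0"
      using L2_norm_nonneg[of M f] by simp
    \<comment> \<open>Half the width is taken so that differences \<open>v - w\<close> stay in the
      strip of width \<open>b\<close>. The net for \<open>?I\<close> also serves \<open>f\<close>,
      since the constant cancels in differences.\<close>
    obtain F where F: "finite F" "F \<subseteq> strip \<beta> (b / 2)"
      "\<And>v. v \<in> strip \<beta> (b / 2) \<Longrightarrow>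
         \<exists>w\<in>F. L2_norm M (\<lambda>x. koopman T v ?I x - koopman T w ?I x) < L2_norm M f / 2"
      using kronecker_finite_net[OF kron, of "b / 2" "L2_norm M f / 2"] b pos by auto
    define c where "c = (L2_norm M f)\<^sup>2 / 2"
    define a where "a u = cmod (L2_inner M (koopman T u f) f)" for u
    have "\<exists>w\<in>F. v - w \<in> strip \<beta> b \<and> c \<le> a (v - w)" if v: "v \<in> strip \<beta> (b / 2)" for v
    proof -
      obtain w where w: "w \<in> F" "L2_norm M (\<lambda>x. koopman T v ?I x - koopman T w ?I x) < L2_norm M f / 2"
        using F(3)[OF v] by blast
      have vw: "(\<lambda>x. koopman T v ?I x - koopman T w ?I x) = (\<lambda>x. koopman T v f x - koopman T w f x)"
        by (simp add: koopman_def f_def)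
      have "w \<in> strip \<beta> (b / 2)"
        using w(1) F(2) by blast
      then have "v - w \<in> strip \<beta> b"
        using v unfolding strip_eq_offset by (simp add: strip_offset_diff)
      have U: "koopman T u f \<in> L2_fun M" for u
        by (rule koopman_L2_fun[OF f])
      have D: "(\<lambda>x. koopman T v f x - koopman T w f x) \<in> L2_fun M"
        by (rule L2_fun_diff[OF U U])
      \<comment> \<open>Since \<open>U^v f\<close> is within \<open>||f|| / 2\<close> of
        \<open>U^w f\<close>, this inner product has modulus at most \<open>||f||^2 / 2\<close>.
        Hence the autocorrelation at \<open>v - w\<close> is at least \<open>c\<close> in
        modulus.\<close>
      have "L2_inner M (\<lambda>x. koopman T v f x - koopman T w f x) (koopman T w f)
          = L2_inner M (koopman T (v - w) f) f - of_real ((L2_norm M f)\<^sup>2)"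
        by (simp only: L2_inner_diff_left[OF U U U] L2_inner_self L2_norm_koopman[OF f] L2_inner_koopman_diff[OF f f])
      moreover have "cmod (L2_inner M (\<lambda>x. koopman T v f x - koopman T w f x) (koopman T w f))
          \<le> L2_norm M (\<lambda>x. koopman T v f x - koopman T w f x) * L2_norm M f"
        using L2_Cauchy_Schwarz[OF D U[of w]] by (simp add: L2_norm_koopman[OF f])
      moreover have "\<dots> \<le> L2_norm M f / 2 * L2_norm M f"
        using w(2) pos unfolding vw by (intro mult_right_mono) auto
      ultimately have "cmod (of_real ((L2_norm M f)\<^sup>2) - L2_inner M (koopman T (v - w) f) f) \<le> c"
        by (simp add: c_def norm_minus_commute power2_eq_square)
      then have "cmod (of_real ((L2_norm M f)\<^sup>2)) - a (v - w) \<le> c"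
        unfolding a_def using norm_triangle_ineq2 order_trans by blast
      then have "c \<le> a (v - w)"
        by (simp add: c_def norm_power)
      with w(1) \<open>v - w \<in> strip \<beta> b\<close> show ?thesis
        by blast
    qed
    note big = this
    have a_le: "a u \<le> L2_norm M f * L2_norm M f" for u
      unfolding a_def using L2_Cauchy_Schwarz[OF koopman_L2_fun[OF f] f] by (simp add: L2_norm_koopman[OF f])
    have a_nonneg: "0 \<le> a u" for u
      by (simp add: a_def)
    let ?N = "\<lambda>k. real (card (strip_upto \<beta> b k))"
    let ?S = "\<lambda>k. \<Sum>v \<in> strip_upto \<beta> b k. a v"
    obtain E where E: "\<And>k. c * real (card (strip_upto \<beta> (b / 2) k)) \<le> real (card F) * (?S k + E)"
      using sum_strip_translates_le[where a = a, OF F(1) a_nonneg a_le less_imp_le[OF b] big] by blast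
    obtain D E' where D: "D > 0" "\<And>k. ?N k \<le> D * (real (card (strip_upto \<beta> (b / 2) k)) + E')"
      using card_strip_upto_compare[OF half_gt_zero[OF b]] by blast
    have c: "c > 0"
      using pos by (simp add: c_def)
    \<comment> \<open>Divided by \<open>?N k\<close>, this becomes \<open>c / D <= 0\<close> in the
      limit, which is impossible.\<close>
    have le: "c * (?N k / D - E') \<le> real (card F) * (?S k + E)" for k
    proof -
      have "?N k / D - E' \<le> real (card (strip_upto \<beta> (b / 2) k))"
        using D(2)[of k] D(1) by (simp add: field_simps)
      then have "c * (?N k / D - E') \<le> c * real (card (strip_upto \<beta> (b / 2) k))"
        using c by (intro mult_left_mono) auto
      with E[of k] show ?thesis
        by linarith
    qed
    have N: "filterlim ?N at_top sequentially"
      by (rule filterlim_card_strip_upto[OF b])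
    have inv: "(\<lambda>k. inverse (?N k)) \<longlonglongrightarrow> 0"
      by (rule tendsto_inverse_0_at_top[OF N])
    have avg: "(\<lambda>k. ?S k / ?N k) \<longlonglongrightarrow> 0"
      using decay[OF f] by (simp add: mean a_def)
    have "(\<lambda>k. c * (1 / D - E' * inverse (?N k))) \<longlonglongrightarrow> c * (1 / D - E' * 0)"
      by (intro tendsto_intros inv)
    moreover have "(\<lambda>k. real (card F) * (?S k / ?N k + E * inverse (?N k))) \<longlonglongrightarrow> real (card F) * (0 + E * 0)"
      by (intro tendsto_intros inv avg)
    moreover have "\<forall>\<^sub>F k in sequentially.
        c * (1 / D - E' * inverse (?N k)) \<le> real (card F) * (?S k / ?N k + E * inverse (?N k))"
    proof -
      have "\<forall>\<^sub>F k in sequentially. ?N k > 0"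
        using N unfolding filterlim_at_top_dense by (rule spec)
      then show ?thesis
      proof eventually_elim
        case (elim k)
        have "c * (?N k / D - E') / ?N k \<le> real (card F) * (?S k + E) / ?N k"
          using le[of k] elim by (intro divide_right_mono) auto
        also have "c * (?N k / D - E') / ?N k = c * (1 / D - E' * inverse (?N k))"
          using elim by (simp add: field_simps)
        also have "real (card F) * (?S k + E) / ?N k = real (card F) * (?S k / ?N k + E * inverse (?N k))"
          by (simp add: divide_inverse algebra_simps)
        finally show ?case .
      qed
    qed
    ultimately have "c * (1 / D - E' * 0) \<le> real (card F) * (0 + E * 0)"
      by (intro tendsto_le[OF sequentially_bot])
    then show False
      using c D(1) by (simp add: mult_le_0_iff divide_le_0_iff)
  qed
  then have "AE x in M. f x = 0"
    using L2_norm_eq_0_iff[OF f] by simp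
  then have "AE x in M. ?I x = of_real (prob B)"
    by eventually_elim (simp add: f_def)
  \<comment> \<open>An indicator that is almost everywhere constant has its constant in {0, 1}; one
    point where equality holds is enough.\<close>
  then have "\<exists>x. ?I x = of_real (prob B)"
    by (rule eventually_happens'[OF ae_filter_bot])
  then obtain x where "complex_of_real (indicat_real B x) = of_real (prob B)"
    unfolding of_real_indicator by blast
  then have "indicat_real B x = prob B"
    unfolding of_real_eq_iff .
  then show "prob B \<in> {0, 1}"
    by (metis indicator_simps insert_iff)
qed

end

section \<open>Finite rank operators along an orbit\<close>

text \<open>The argument of the projection theorem for a decreasing sequence of sets. The infima
  \<open>a n\<close> increase to a limit \<open>l\<close>. For \<open>m, n >= N\<close> the midpoint
  of \<open>p m\<close> and \<open>p n\<close> stays in \<open>C N\<close>, so its value is at least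
  \<open>a N\<close>, and the parallelogram law bounds \<open>Q (p m - p n)\<close> by
  \<open>4 (l - a N) + 4 / (N + 1)\<close>.\<close>

lemma minimizing_sequence_Cauchy:
  fixes Q :: "('i \<Rightarrow> real) \<Rightarrow> real" and C :: "nat \<Rightarrow> ('i \<Rightarrow> real) set"
  assumes ne: "\<And>n. C n \<noteq> {}" and anti: "\<And>m n. m \<le> n \<Longrightarrow> C n \<subseteq> C m"
    and mid: "\<And>n p q. p \<in> C n \<Longrightarrow> q \<in> C n \<Longrightarrow> (\<lambda>i. (p i + q i) / 2) \<in> C n"
    and Q_nonneg: "\<And>p. p \<in> C 0 \<Longrightarrow> 0 \<le> Q p" and Q_le: "\<And>p. p \<in> C 0 \<Longrightarrow> Q p \<le> B"
    and parallelogram: "\<And>p q. p \<in> C 0 \<Longrightarrow> q \<in> C 0 \<Longrightarrow>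
      Q (\<lambda>i. p i - q i) = 2 * Q p + 2 * Q q - 4 * Q (\<lambda>i. (p i + q i) / 2)"
  obtains p where "\<And>n. p n \<in> C n"
    "\<And>e. e > 0 \<Longrightarrow> \<exists>N. \<forall>m\<ge>N. \<forall>n\<ge>N. Q (\<lambda>i. p m i - p n i) < e"
proof -
  have C0: "p \<in> C 0" if "p \<in> C n" for p n
    using anti[of 0 n] that by auto
  define a where "a n = Inf (Q ` C n)" for n
  have bdd: "bdd_below (Q ` C n)" for n
    by (rule bdd_belowI[of _ 0]) (use Q_nonneg C0 in auto)
  have a_le: "a n \<le> Q p" if "p \<in> C n" for n p
    unfolding a_def by (rule cInf_lower) (use that bdd in auto)
  have a_le_B: "a n \<le> B" for n
    using ne[of n] a_le Q_le C0 order_trans by blast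
  have "incseq a"
    unfolding a_def incseq_def using ne anti bdd by (intro allI impI cInf_superset_mono image_mono) auto
  moreover have "bdd_above (range a)"
    using a_le_B by (intro bdd_aboveI[of _ B]) auto
  ultimately have conv: "a \<longlonglongrightarrow> (SUP n. a n)"
    by (rule LIMSEQ_incseq_SUP[rotated])
  define l where "l = (SUP n. a n)"
  have a_le_l: "a n \<le> l" for n
    unfolding l_def by (intro cSUP_upper \<open>bdd_above (range a)\<close>) auto
  have "\<exists>p \<in> C n. Q p < a n + 1 / real (Suc n)" for n
  proof -
    have "\<exists>y \<in> Q ` C n. y < a n + 1 / real (Suc n)"
      using cInf_lessD[of "Q ` C n" "a n + 1 / real (Suc n)"] ne[of n] by (auto simp: a_def)
    then show ?thesis
      by blast
  qed
  then obtain p where p: "p n \<in> C n" "Q (p n) < a n + 1 / real (Suc n)" for n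
    by metis
  have "\<exists>N. \<forall>m\<ge>N. \<forall>n\<ge>N. Q (\<lambda>i. p m i - p n i) < e" if e: "e > 0" for e
  proof -
    have "(\<lambda>N. 4 * (l - a N) + 4 * inverse (real (Suc N))) \<longlonglongrightarrow> 4 * (l - l) + 4 * 0"
      using conv unfolding l_def[symmetric]
      by (intro tendsto_intros LIMSEQ_inverse_real_of_nat)
    then have "\<forall>\<^sub>F N in sequentially. 4 * (l - a N) + 4 * inverse (real (Suc N)) < e"
      by (rule order_tendstoD) (use e in simp)
    then obtain N where N: "4 * (l - a N) + 4 * inverse (real (Suc N)) < e"
      using eventually_happens'[OF sequentially_bot] by blast
    have "Q (\<lambda>i. p m i - p n i) < e" if mn: "m \<ge> N" "n \<ge> N" for m n
    proof -
      have upper: "Q (p k) \<le> l + inverse (real (Suc N))" if "k \<ge> N" for k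
      proof -
        have "1 / real (Suc k) \<le> inverse (real (Suc N))"
          using that by (simp add: inverse_eq_divide frac_le)
        then show ?thesis
          using p(2)[of k] a_le_l[of k] by linarith
      qed
      have "p m \<in> C N" "p n \<in> C N"
        using p(1) anti mn by blast+
      then have mid_ge: "a N \<le> Q (\<lambda>i. (p m i + p n i) / 2)"
        by (intro a_le mid)
      have "2 * x + 2 * y - 4 * z < e"
        if "x \<le> l + inverse (real (Suc N))" "y \<le> l + inverse (real (Suc N))" "a N \<le> z" for x y z
        using that N by argo
      then show ?thesis
        unfolding parallelogram[OF C0[OF p(1)[of m]] C0[OF p(1)[of n]]]
        using upper[OF mn(1)] upper[OF mn(2)] mid_ge .
    qed
    then show ?thesis
      by blast
  qed
  with p(1) show ?thesis
    by (rule that)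
qed

text \<open>Each coefficient is rounded to a finite \<open>r\<close>-net of the disc of radius
  \<open>R\<close>. The set \<open>W \<rightarrow>\<^sub>E Z\<close> fixes the coefficient functions
  outside \<open>W\<close>, which makes it finite.\<close>

lemma finite_net_of_lincombs:
  assumes W: "finite W" and g: "\<And>v. v \<in> W \<Longrightarrow> g v \<in> L2_fun M" and e: "e > 0"
  obtains N where "finite N" "N \<subseteq> L2_fun M"
    "\<forall>z. (\<forall>v\<in>W. cmod (z v) \<le> R) \<longrightarrow> (\<exists>h\<in>N. L2_norm M (\<lambda>x. (\<Sum>v\<in>W. z v * g v x) - h x) < e)"
proof -
  define G where "G = (\<Sum>v\<in>W. L2_norm M (g v))"
  have G: "G \<ge> 0"
    unfolding G_def by (intro sum_nonneg L2_norm_nonneg)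
  define r where "r = e / (G + 1)"
  have r: "r > 0"
    using e G by (simp add: r_def)
  obtain Z where Z: "finite Z" "cball (0::complex) R \<subseteq> (\<Union>z\<in>Z. ball z r)"
    using compact_cball[of "0::complex" R] r unfolding compact_eq_totally_bounded by meson
  define comb where "comb \<zeta> = (\<lambda>x. \<Sum>v\<in>W. \<zeta> v * g v x)" for \<zeta>
  define N where "N = comb ` (W \<rightarrow>\<^sub>E Z)"
  show ?thesis
  proof
    show "finite N"
      unfolding N_def using W Z(1) by (intro finite_imageI finite_PiE) auto
    show "N \<subseteq> L2_fun M"
      unfolding N_def comb_def using g by (auto intro: L2_fun_lincomb)
  next
    show "\<forall>z. (\<forall>v\<in>W. cmod (z v) \<le> R) \<longrightarrow> (\<exists>h\<in>N. L2_norm M (\<lambda>x. (\<Sum>v\<in>W. z v * g v x) - h x) < e)"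
    proof (intro allI impI)
      fix z assume z: "\<forall>v\<in>W. cmod (z v) \<le> R"
      have "\<exists>\<zeta>\<in>Z. cmod (z v - \<zeta>) < r" if "v \<in> W" for v
      proof -
        have "z v \<in> (\<Union>z\<in>Z. ball z r)"
          by (rule subsetD[OF Z(2)]) (use z that in simp)
        then show ?thesis
          by (auto simp: dist_norm norm_minus_commute)
      qed
      then obtain \<zeta> where \<zeta>: "\<And>v. v \<in> W \<Longrightarrow> \<zeta> v \<in> Z \<and> cmod (z v - \<zeta> v) < r"
        by metis
      have "L2_norm M (\<lambda>x. (\<Sum>v\<in>W. z v * g v x) - comb (restrict \<zeta> W) x)
          = L2_norm M (\<lambda>x. \<Sum>v\<in>W. (z v - \<zeta> v) * g v x)"
        unfolding comb_def by (simp add: left_diff_distrib sum_subtractf)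
      also have "\<dots> \<le> (\<Sum>v\<in>W. L2_norm M (\<lambda>x. (z v - \<zeta> v) * g v x))"
        by (intro L2_norm_sum L2_fun_cmult g)
      also have "\<dots> \<le> (\<Sum>v\<in>W. r * L2_norm M (g v))"
        unfolding L2_norm_cmult using \<zeta> L2_norm_nonneg by (intro sum_mono mult_right_mono) (auto intro: less_imp_le)
      also have "\<dots> = r * G"
        by (simp add: G_def sum_distrib_left)
      also have "\<dots> < e"
        using e G by (simp add: r_def field_simps)
      finally have "L2_norm M (\<lambda>x. (\<Sum>v\<in>W. z v * g v x) - comb (restrict \<zeta> W) x) < e" .
      moreover have "comb (restrict \<zeta> W) \<in> N"
        unfolding N_def using \<zeta> by (intro imageI) auto
      ultimately show "\<exists>h\<in>N. L2_norm M (\<lambda>x. (\<Sum>v\<in>W. z v * g v x) - h x) < e"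
        by blast
    qed
  qed
qed

context Z2_mpds
begin

text \<open>The operator \<open>A_c\<close>. Summing over the support makes it a finite rank
  operator for finitely supported \<open>c\<close>.\<close>

definition orbit_op :: "('a \<Rightarrow> complex) \<Rightarrow> (int \<times> int \<Rightarrow> real) \<Rightarrow> ('a \<Rightarrow> complex) \<Rightarrow> 'a \<Rightarrow> complex" where
  "orbit_op f c h = (\<lambda>x. \<Sum>v | c v \<noteq> 0. of_real (c v) * L2_inner M h (koopman T v f) * koopman T v f x)"

text \<open>For finitely supported \<open>c\<close> this is the squared Hilbert-Schmidt norm of
  \<open>orbit_op f c\<close>, written through the Gram matrix of the orbit.\<close>

definition orbit_form :: "('a \<Rightarrow> complex) \<Rightarrow> (int \<times> int \<Rightarrow> real) \<Rightarrow> real" where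
  "orbit_form f c = (\<Sum>v | c v \<noteq> 0. \<Sum>w | c w \<noteq> 0.
     c v * c w * (cmod (L2_inner M (koopman T v f) (koopman T w f)))\<^sup>2)"

section \<open>Algebra and norm estimates for the orbit operators\<close>

lemma orbit_op_superset:
  assumes "finite W" "{v. c v \<noteq> 0} \<subseteq> W"
  shows "orbit_op f c h = (\<lambda>x. \<Sum>v\<in>W. of_real (c v) * L2_inner M h (koopman T v f) * koopman T v f x)"
  unfolding orbit_op_def using assms by (intro ext sum.mono_neutral_left) auto

lemma orbit_form_superset:
  assumes "finite W" "{v. c v \<noteq> 0} \<subseteq> W"
  shows "orbit_form f c = (\<Sum>v\<in>W. \<Sum>w\<in>W. c v * c w * (cmod (L2_inner M (koopman T v f) (koopman T w f)))\<^sup>2)"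
proof -
  have "(\<Sum>w | c w \<noteq> 0. c v * c w * (cmod (L2_inner M (koopman T v f) (koopman T w f)))\<^sup>2)
      = (\<Sum>w\<in>W. c v * c w * (cmod (L2_inner M (koopman T v f) (koopman T w f)))\<^sup>2)" for v
    using assms by (intro sum.mono_neutral_left) auto
  then show ?thesis
    unfolding orbit_form_def using assms by (simp only:) (intro sum.mono_neutral_left, auto)
qed

lemma orbit_op_L2_fun: "f \<in> L2_fun M \<Longrightarrow> orbit_op f c h \<in> L2_fun M"
  unfolding orbit_op_def by (intro L2_fun_lincomb koopman_L2_fun)

lemma orbit_op_diff:
  assumes "finite {v. c v \<noteq> 0}" "finite {v. d v \<noteq> 0}"
  shows "orbit_op f (\<lambda>v. c v - d v) h x = orbit_op f c h x - orbit_op f d h x"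
proof -
  have W: "finite ({v. c v \<noteq> 0} \<union> {v. d v \<noteq> 0})"
    using assms by simp
  show ?thesis
    by (subst (1 2 3) orbit_op_superset[OF W]) (auto simp: left_diff_distrib simp flip: sum_subtractf)
qed

text \<open>Since \<open>U^u\<close> preserves inner products,
  \<open><h, U^v f> = <U^u h, U^(v+u) f>\<close>; reindexing by \<open>v + u\<close> translates the
  weights.\<close>

lemma koopman_orbit_op:
  assumes f: "f \<in> L2_fun M" and h: "h \<in> L2_fun M"
  shows "koopman T u (orbit_op f c h) = orbit_op f (\<lambda>v. c (v - u)) (koopman T u h)"
proof
  fix x
  have "v \<in> (\<lambda>v. v + u) ` {v. c v \<noteq> 0}" if "c (v - u) \<noteq> 0" for v
    by (rule image_eqI[where x = "v - u"]) (use that in simp_all)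
  then have "{v. c (v - u) \<noteq> 0} = (\<lambda>v. v + u) ` {v. c v \<noteq> 0}"
    by auto
  then have "orbit_op f (\<lambda>v. c (v - u)) (koopman T u h) x
      = (\<Sum>v | c v \<noteq> 0. of_real (c v) * L2_inner M (koopman T u h) (koopman T (v + u) f) * koopman T (v + u) f x)"
    unfolding orbit_op_def by (simp add: sum.reindex inj_on_def)
  also have "\<dots> = (\<Sum>v | c v \<noteq> 0. of_real (c v) * L2_inner M h (koopman T v f) * koopman T v f (T u x))"
    by (simp only: koopman_add L2_inner_koopman[OF h koopman_L2_fun[OF f]]) (simp add: koopman_def)
  also have "\<dots> = koopman T u (orbit_op f c h) x"
    by (simp add: orbit_op_def koopman_def)
  finally show "koopman T u (orbit_op f c h) x = orbit_op f (\<lambda>v. c (v - u)) (koopman T u h) x" ..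
qed

text \<open>Each summand is a rank one operator of norm \<open>|c v| ||f||^2\<close>. This turns
  closeness of weights in \<open>l^1\<close> into closeness of operators.\<close>

lemma L2_norm_orbit_op_le_l1:
  assumes f: "f \<in> L2_fun M" and h: "h \<in> L2_fun M"
  shows "L2_norm M (orbit_op f c h) \<le> (\<Sum>v | c v \<noteq> 0. \<bar>c v\<bar>) * ((L2_norm M f)\<^sup>2 * L2_norm M h)"
proof -
  have "L2_norm M (orbit_op f c h)
      \<le> (\<Sum>v | c v \<noteq> 0. L2_norm M (\<lambda>x. of_real (c v) * L2_inner M h (koopman T v f) * koopman T v f x))"
    unfolding orbit_op_def by (intro L2_norm_sum L2_fun_cmult koopman_L2_fun f)
  also have "\<dots> \<le> (\<Sum>v | c v \<noteq> 0. \<bar>c v\<bar> * ((L2_norm M f)\<^sup>2 * L2_norm M h))"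
  proof (rule sum_mono)
    fix v
    have "cmod (L2_inner M h (koopman T v f)) \<le> L2_norm M h * L2_norm M f"
      using L2_Cauchy_Schwarz[OF h koopman_L2_fun[OF f, of v]] by (simp add: L2_norm_koopman[OF f])
    then have "\<bar>c v\<bar> * cmod (L2_inner M h (koopman T v f)) * L2_norm M f
        \<le> \<bar>c v\<bar> * (L2_norm M h * L2_norm M f) * L2_norm M f"
      by (intro mult_right_mono mult_left_mono L2_norm_nonneg) auto
    then show "L2_norm M (\<lambda>x. of_real (c v) * L2_inner M h (koopman T v f) * koopman T v f x)
        \<le> \<bar>c v\<bar> * ((L2_norm M f)\<^sup>2 * L2_norm M h)"
      by (simp only: L2_norm_cmult L2_norm_koopman[OF f] norm_mult norm_of_real) (simp add: power2_eq_square mult_ac)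
  qed
  also have "\<dots> = (\<Sum>v | c v \<noteq> 0. \<bar>c v\<bar>) * ((L2_norm M f)\<^sup>2 * L2_norm M h)"
    by (simp add: sum_distrib_right)
  finally show ?thesis .
qed

lemma L2_norm_orbit_op_le_form:
  assumes f: "f \<in> L2_fun M" and h: "h \<in> L2_fun M"
  shows "(L2_norm M (orbit_op f c h))\<^sup>2 \<le> orbit_form f c * (L2_norm M h)\<^sup>2"
    and orbit_form_nonneg: "0 \<le> orbit_form f c"
  unfolding orbit_op_def orbit_form_def
  by (rule L2_norm_finite_rank_le[OF koopman_L2_fun[OF f] h])+

lemma orbit_form_parallelogram:
  assumes "finite {v. c v \<noteq> 0}" "finite {v. d v \<noteq> 0}"
  shows "orbit_form f (\<lambda>v. c v - d v)
    = 2 * orbit_form f c + 2 * orbit_form f d - 4 * orbit_form f (\<lambda>v. (c v + d v) / 2)"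
proof -
  define W where "W = {v. c v \<noteq> 0} \<union> {v. d v \<noteq> 0}"
  have W: "finite W"
    unfolding W_def using assms by simp
  define K where "K v w = (cmod (L2_inner M (koopman T v f) (koopman T w f)))\<^sup>2" for v w
  have eq: "orbit_form f c' = (\<Sum>v\<in>W. \<Sum>w\<in>W. c' v * c' w * K v w)" if "{v. c' v \<noteq> 0} \<subseteq> W" for c'
    unfolding K_def by (rule orbit_form_superset[OF W that])
  have "orbit_form f (\<lambda>v. c v - d v) + 4 * orbit_form f (\<lambda>v. (c v + d v) / 2)
      = (\<Sum>v\<in>W. \<Sum>w\<in>W. (c v - d v) * (c w - d w) * K v w + 4 * ((c v + d v) / 2 * ((c w + d w) / 2) * K v w))"
    by (subst (1 2) eq) (auto simp: W_def sum.distrib sum_distrib_left)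
  also have "\<dots> = (\<Sum>v\<in>W. \<Sum>w\<in>W. 2 * (c v * c w * K v w) + 2 * (d v * d w * K v w))"
    by (intro sum.cong refl) (simp add: algebra_simps)
  also have "\<dots> = 2 * orbit_form f c + 2 * orbit_form f d"
    by (subst (1 2) eq) (auto simp: W_def sum.distrib sum_distrib_left)
  finally show ?thesis
    by simp
qed

lemma orbit_form_le:
  assumes f: "f \<in> L2_fun M" and L: "(\<Sum>v | c v \<noteq> 0. \<bar>c v\<bar>) \<le> L"
  shows "orbit_form f c \<le> L\<^sup>2 * (L2_norm M f) ^ 4"
proof -
  have "orbit_form f c \<le> (\<Sum>v | c v \<noteq> 0. \<Sum>w | c w \<noteq> 0. \<bar>c v\<bar> * \<bar>c w\<bar> * (L2_norm M f) ^ 4)"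
    unfolding orbit_form_def
  proof (intro sum_mono)
    fix v w
    have "(cmod (L2_inner M (koopman T v f) (koopman T w f)))\<^sup>2 \<le> (L2_norm M f * L2_norm M f)\<^sup>2"
      using L2_Cauchy_Schwarz[OF koopman_L2_fun[OF f, of v] koopman_L2_fun[OF f, of w]]
      by (intro power_mono) (simp_all add: L2_norm_koopman[OF f])
    also have "\<dots> = (L2_norm M f) ^ 4"
      by (simp add: power2_eq_square power4_eq_xxxx)
    finally have "\<bar>c v * c w\<bar> * (cmod (L2_inner M (koopman T v f) (koopman T w f)))\<^sup>2
        \<le> \<bar>c v * c w\<bar> * (L2_norm M f) ^ 4"
      by (rule mult_left_mono) simp
    then show "c v * c w * (cmod (L2_inner M (koopman T v f) (koopman T w f)))\<^sup>2
        \<le> \<bar>c v\<bar> * \<bar>c w\<bar> * (L2_norm M f) ^ 4"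
      unfolding abs_mult
      by (rule order_trans[rotated]) (simp add: mult_right_mono flip: abs_mult)
  qed
  also have "\<dots> = (\<Sum>v | c v \<noteq> 0. \<bar>c v\<bar>)\<^sup>2 * (L2_norm M f) ^ 4"
    by (simp add: power2_eq_square sum_distrib_left sum_distrib_right mult_ac)
  also have "\<dots> \<le> L\<^sup>2 * (L2_norm M f) ^ 4"
    using L by (intro mult_right_mono power_mono sum_nonneg) auto
  finally show ?thesis .
qed

text \<open>The value at \<open>h\<close> is the weighted sum of the squared correlations. A lower
  bound for that sum therefore survives in the limit and keeps it from being orthogonal to
  \<open>h\<close>.\<close>

lemma L2_inner_orbit_op:
  assumes f: "f \<in> L2_fun M" and h: "h \<in> L2_fun M"
  shows "L2_inner M (orbit_op f c h) h = of_real (\<Sum>v | c v \<noteq> 0. c v * (cmod (L2_inner M (koopman T v f) h))\<^sup>2)"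
proof -
  have "L2_inner M (orbit_op f c h) h
      = (\<Sum>v | c v \<noteq> 0. of_real (c v) * L2_inner M h (koopman T v f) * L2_inner M (koopman T v f) h)"
    unfolding orbit_op_def by (intro L2_inner_lincomb_left koopman_L2_fun f h)
  also have "\<dots> = (\<Sum>v | c v \<noteq> 0. of_real (c v * (cmod (L2_inner M (koopman T v f) h))\<^sup>2))"
  proof (intro sum.cong refl)
    fix v
    have "L2_inner M h (koopman T v f) * L2_inner M (koopman T v f) h
        = of_real ((cmod (L2_inner M (koopman T v f) h))\<^sup>2)"
      unfolding L2_inner_commute[of M h "koopman T v f"] complex_norm_square by (rule mult.commute)
    then show "of_real (c v) * L2_inner M h (koopman T v f) * L2_inner M (koopman T v f) h
        = of_real (c v * (cmod (L2_inner M (koopman T v f) h))\<^sup>2)"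
      by (simp only: mult.assoc of_real_mult)
  qed
  finally show ?thesis
    by simp
qed

lemma L2_inner_koopman_one:
  assumes f: "f \<in> L2_fun M"
  shows "L2_inner M (koopman T v f) (\<lambda>_. 1) = L2_inner M f (\<lambda>_. 1)"
  using L2_inner_koopman[OF f L2_fun_const[of 1], of v] by (simp add: koopman_def comp_def)

lemma L2_inner_orbit_op_one:
  assumes f: "f \<in> L2_fun M" and mean: "L2_inner M f (\<lambda>_. 1) = 0"
  shows "L2_inner M (orbit_op f c h) (\<lambda>_. 1) = 0"
  unfolding orbit_op_def L2_inner_lincomb_left[OF koopman_L2_fun[OF f] L2_fun_const]
  by (simp add: L2_inner_koopman_one[OF f] mean)

end

section \<open>Almost invariant weights\<close>

text \<open>
  For a finitely supported \<open>c\<close>, quantifying over finite \<open>W\<close> bounds the \<open>l\<^sup>1\<close>-norm. As \<open>\<epsilon>\<close> tends to 0, a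
  translation by \<open>u\<close> changes \<open>c\<close> in \<open>l\<^sup>1\<close> only by a multiple of the distance of \<open>u\<close> to the line, which is
  all the invariance that a strip offers.
\<close>

definition almost_invariant_weights ::
  "real \<Rightarrow> real \<Rightarrow> real \<Rightarrow> real \<Rightarrow> (int \<times> int \<Rightarrow> real) \<Rightarrow> real \<Rightarrow> (int \<times> int \<Rightarrow> real) set" where
  "almost_invariant_weights \<beta> b L \<delta> a \<epsilon> = {c. finite {v. c v \<noteq> 0} \<and>
     (\<forall>W. finite W \<longrightarrow> (\<Sum>v\<in>W. \<bar>c v\<bar>) \<le> L) \<and> \<delta> \<le> (\<Sum>v | c v \<noteq> 0. c v * a v) \<and>
     (\<forall>u \<in> strip \<beta> b. \<forall>W. finite W \<longrightarrow>
        (\<Sum>v\<in>W. \<bar>c (v - u) - c v\<bar>) \<le> \<epsilon> * \<bar>of_int (fst u)\<bar> + L * \<bar>strip_offset \<beta> u\<bar>)}"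

lemma almost_invariant_weightsD:
  assumes "c \<in> almost_invariant_weights \<beta> b L \<delta> a \<epsilon>"
  shows "finite {v. c v \<noteq> 0}" "finite W \<Longrightarrow> (\<Sum>v\<in>W. \<bar>c v\<bar>) \<le> L" "\<delta> \<le> (\<Sum>v | c v \<noteq> 0. c v * a v)"
    "u \<in> strip \<beta> b \<Longrightarrow> finite W \<Longrightarrow>
      (\<Sum>v\<in>W. \<bar>c (v - u) - c v\<bar>) \<le> \<epsilon> * \<bar>of_int (fst u)\<bar> + L * \<bar>strip_offset \<beta> u\<bar>"
  using assms by (simp_all add: almost_invariant_weights_def)

lemma almost_invariant_weights_mono:
  assumes "\<epsilon> \<le> \<epsilon>'"
  shows "almost_invariant_weights \<beta> b L \<delta> a \<epsilon> \<subseteq> almost_invariant_weights \<beta> b L \<delta> a \<epsilon>'"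
proof -
  have "\<epsilon> * \<bar>of_int (fst u)\<bar> + r \<le> \<epsilon>' * \<bar>of_int (fst u)\<bar> + r" for r and u :: "int \<times> int"
    using assms by (intro add_right_mono mult_right_mono) auto
  then show ?thesis
    unfolding almost_invariant_weights_def by (blast intro: order_trans)
qed

text \<open>Each \<open>l^1\<close> bound is convex in the weights, and the sum against
  \<open>a\<close> is linear once it is taken over the union of both supports.\<close>

lemma almost_invariant_weights_midpoint:
  assumes c: "c \<in> almost_invariant_weights \<beta> b L \<delta> a \<epsilon>" and d: "d \<in> almost_invariant_weights \<beta> b L \<delta> a \<epsilon>"
  shows "(\<lambda>v. (c v + d v) / 2) \<in> almost_invariant_weights \<beta> b L \<delta> a \<epsilon>"
proof -
  note C = almost_invariant_weightsD[OF c] and D = almost_invariant_weightsD[OF d]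
  let ?m = "\<lambda>v. (c v + d v) / 2"
  let ?U = "{v. c v \<noteq> 0} \<union> {v. d v \<noteq> 0}"
  have U: "finite ?U"
    using C(1) D(1) by simp
  have "finite {v. ?m v \<noteq> 0}"
    by (rule finite_subset[OF _ U]) auto
  moreover have "(\<Sum>v\<in>W. \<bar>?m v\<bar>) \<le> L" if W: "finite W" for W
  proof -
    have "\<bar>(r + s) / 2\<bar> \<le> \<bar>r\<bar> / 2 + \<bar>s\<bar> / 2" for r s :: real
      using abs_triangle_ineq[of r s] by (simp add: abs_divide flip: add_divide_distrib)
    then have "(\<Sum>v\<in>W. \<bar>?m v\<bar>) \<le> (\<Sum>v\<in>W. \<bar>c v\<bar> / 2 + \<bar>d v\<bar> / 2)"
      by (intro sum_mono)
    also have "\<dots> = (\<Sum>v\<in>W. \<bar>c v\<bar>) / 2 + (\<Sum>v\<in>W. \<bar>d v\<bar>) / 2"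
      by (simp add: sum.distrib sum_divide_distrib)
    finally show ?thesis
      using C(2)[OF W] D(2)[OF W] by linarith
  qed
  moreover have "\<delta> \<le> (\<Sum>v | ?m v \<noteq> 0. ?m v * a v)"
  proof -
    have 1: "(\<Sum>v | c v \<noteq> 0. c v * a v) = (\<Sum>v\<in>?U. c v * a v)"
      by (rule sum.mono_neutral_left[OF U]) auto
    have 2: "(\<Sum>v | d v \<noteq> 0. d v * a v) = (\<Sum>v\<in>?U. d v * a v)"
      by (rule sum.mono_neutral_left[OF U]) auto
    have "(\<Sum>v | ?m v \<noteq> 0. ?m v * a v) = (\<Sum>v\<in>?U. ?m v * a v)"
      by (rule sum.mono_neutral_left[OF U]) auto
    also have "\<dots> = (\<Sum>v\<in>?U. c v * a v / 2 + d v * a v / 2)"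
      by (intro sum.cong refl) (simp add: field_simps)
    also have "\<dots> = (\<Sum>v\<in>?U. c v * a v) / 2 + (\<Sum>v\<in>?U. d v * a v) / 2"
      by (simp add: sum.distrib sum_divide_distrib)
    finally show ?thesis
      using C(3) D(3) unfolding 1 2 by linarith
  qed
  moreover have "(\<Sum>v\<in>W. \<bar>?m (v - u) - ?m v\<bar>) \<le> \<epsilon> * \<bar>of_int (fst u)\<bar> + L * \<bar>strip_offset \<beta> u\<bar>"
    if u: "u \<in> strip \<beta> b" and W: "finite W" for u W
  proof -
    have "\<bar>(r + s) / 2 - (r' + s') / 2\<bar> \<le> \<bar>r - r'\<bar> / 2 + \<bar>s - s'\<bar> / 2" for r s r' s' :: real
    proof -
      have "(r + s) / 2 - (r' + s') / 2 = (r - r') / 2 + (s - s') / 2"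
        by (simp add: field_simps)
      then show ?thesis
        using abs_triangle_ineq[of "(r - r') / 2" "(s - s') / 2"] by (simp only: abs_divide abs_numeral)
    qed
    then have "(\<Sum>v\<in>W. \<bar>?m (v - u) - ?m v\<bar>) \<le> (\<Sum>v\<in>W. \<bar>c (v - u) - c v\<bar> / 2 + \<bar>d (v - u) - d v\<bar> / 2)"
      by (intro sum_mono)
    also have "\<dots> = (\<Sum>v\<in>W. \<bar>c (v - u) - c v\<bar>) / 2 + (\<Sum>v\<in>W. \<bar>d (v - u) - d v\<bar>) / 2"
      by (simp add: sum.distrib sum_divide_distrib)
    finally show ?thesis
      using C(4)[OF u W] D(4)[OF u W] by linarith
  qed
  ultimately show ?thesis
    unfolding almost_invariant_weights_def by blast
qed

lemma sum_if_mem_le: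
  fixes x :: real
  assumes "finite W" "finite X" "x \<ge> 0"
  shows "(\<Sum>v\<in>W. if v \<in> X then x else 0) \<le> real (card X) * x"
proof -
  have "(\<Sum>v\<in>W. if v \<in> X then x else 0) = real (card (W \<inter> X)) * x"
    using assms(1) by (simp flip: sum.inter_restrict)
  also have "\<dots> \<le> real (card X) * x"
    using assms by (intro mult_right_mono) (auto intro: card_mono)
  finally show ?thesis .
qed

text \<open>\<open>L\<close> adds two constants. At most \<open>(4 * b + 1) * k\<close> points of
  weight at most \<open>2 / k\<close> give the mass; a tent of slope \<open>1 / b\<close>, felt on
  at most \<open>(6 * b + 1) * k\<close> points, gives the cost of a transversal shift.\<close>

lemma almost_invariant_weights_exist:
  assumes b: "b > 0" and a: "\<And>v. 0 \<le> a v"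
    and freq: "\<And>K. \<exists>k\<ge>K. \<delta> * real k \<le> (\<Sum>v \<in> strip_upto \<beta> b k. a v)"
    and L: "L = 2 * (4 * b + 1) + (6 * b + 1) / b" and \<epsilon>: "\<epsilon> > 0"
  shows "almost_invariant_weights \<beta> b L \<delta> a \<epsilon> \<noteq> {}"
proof -
  \<comment> \<open>The window is long enough for the boundary columns of a shift to cost at most
    \<open>\<epsilon>\<close> per unit of horizontal displacement.\<close>
  obtain k where k: "nat \<lceil>4 * (6 * b + 1) / \<epsilon>\<rceil> + 1 \<le> k" "\<delta> * real k \<le> (\<Sum>v \<in> strip_upto \<beta> b k. a v)"
    using freq by blast
  have k_pos: "real k > 0"
    using k(1) by simp
  have "4 * (6 * b + 1) / \<epsilon> \<le> real k"
    using k(1) by linarith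
  then have k_ge: "4 * (6 * b + 1) / real k \<le> \<epsilon>"
    using \<epsilon> k_pos by (simp add: field_simps)
  define \<phi> where "\<phi> x = max 0 (2 - \<bar>x\<bar> / b)" for x
  have \<phi>_nonneg: "0 \<le> \<phi> x" and \<phi>_le: "\<phi> x \<le> 2" for x
    using b by (auto simp: \<phi>_def)
  have \<phi>_ge: "1 \<le> \<phi> x" if "\<bar>x\<bar> \<le> b" for x
    using b that by (simp add: \<phi>_def le_max_iff_disj field_simps)
  have \<phi>_0: "\<phi> x = 0" if "\<bar>x\<bar> > 2 * b" for x
    using b that by (simp add: \<phi>_def field_simps)
  have \<phi>_lip: "\<bar>\<phi> x - \<phi> y\<bar> \<le> \<bar>x - y\<bar> / b" for x y
  proof -
    have "\<bar>\<phi> x - \<phi> y\<bar> \<le> \<bar>\<bar>x\<bar> / b - \<bar>y\<bar> / b\<bar>"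
      by (auto simp: \<phi>_def max_def)
    also have "\<dots> = \<bar>\<bar>x\<bar> - \<bar>y\<bar>\<bar> / b"
      using b by (simp add: abs_divide flip: diff_divide_distrib)
    also have "\<dots> \<le> \<bar>x - y\<bar> / b"
      using b by (intro divide_right_mono) auto
    finally show ?thesis .
  qed
  \<comment> \<open>average over \<open>[0, k)\<close> along the strip, tapered by the tent \<open>\<phi>\<close> across it; the Lipschitz
    continuity of \<open>\<phi>\<close> replaces invariance under transversal shifts\<close>
  define c where "c v = (if fst v \<in> {0..<int k} then \<phi> (strip_offset \<beta> v) / real k else 0)" for v :: "int \<times> int"
  let ?S2 = "strip \<beta> (2 * b) \<inter> ({0..<int k} \<times> UNIV)"
  \<comment> \<open>The weights vanish beyond offset \<open>2 * b\<close>, and a shift by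
    \<open>u\<close> in \<open>strip \<beta> b\<close> moves offsets by at most
    \<open>b\<close>.\<close>
  let ?S3 = "strip \<beta> (3 * b) \<inter> ({0..<int k} \<times> UNIV)"
  have S2: "finite ?S2" "real (card ?S2) \<le> (4 * b + 1) * real k"
    using strip_window[of "{0..<int k}" "2 * b" \<beta>] b by auto
  have S3: "finite ?S3" "real (card ?S3) \<le> (6 * b + 1) * real k"
    using strip_window[of "{0..<int k}" "3 * b" \<beta>] b by auto
  have supp: "{v. c v \<noteq> 0} \<subseteq> ?S2"
    using \<phi>_0 by (auto simp: c_def strip_eq_offset not_less split: if_splits intro: leI)
  have c_nonneg: "0 \<le> c v" for v
    using \<phi>_nonneg by (simp add: c_def)
  have "finite {v. c v \<noteq> 0}"
    using supp S2(1) by (rule finite_subset)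
  moreover have "(\<Sum>v\<in>W. \<bar>c v\<bar>) \<le> L" if W: "finite W" for W
  proof -
    have "\<bar>c v\<bar> \<le> (if v \<in> ?S2 then 2 / real k else 0)" for v
    proof (cases "c v = 0")
      case False
      then have "v \<in> ?S2"
        using supp by blast
      moreover have "c v \<le> 2 / real k"
        using \<phi>_le by (simp add: c_def divide_right_mono)
      ultimately show ?thesis
        using c_nonneg by (simp only: if_True abs_of_nonneg)
    qed simp
    then have "(\<Sum>v\<in>W. \<bar>c v\<bar>) \<le> (\<Sum>v\<in>W. if v \<in> ?S2 then 2 / real k else 0)"
      by (rule sum_mono)
    also have "\<dots> \<le> real (card ?S2) * (2 / real k)"
      using W S2 by (intro sum_if_mem_le) auto
    also have "\<dots> \<le> (4 * b + 1) * real k * (2 / real k)"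
      using S2 by (intro mult_right_mono) auto
    also have "\<dots> \<le> L"
      using k_pos b by (simp add: L)
    finally show ?thesis .
  qed
  moreover have "\<delta> \<le> (\<Sum>v | c v \<noteq> 0. c v * a v)"
  proof -
    have "\<delta> \<le> (\<Sum>v \<in> strip_upto \<beta> b k. a v) / real k"
      using k(2) k_pos by (simp add: field_simps)
    also have "\<dots> = (\<Sum>v \<in> strip_upto \<beta> b k. 1 / real k * a v)"
      by (simp add: sum_divide_distrib)
    also have "\<dots> \<le> (\<Sum>v \<in> strip_upto \<beta> b k. c v * a v)"
    proof (intro sum_mono mult_right_mono a)
      fix v assume "v \<in> strip_upto \<beta> b k"
      then have "\<bar>strip_offset \<beta> v\<bar> \<le> b" "fst v \<in> {0..<int k}"
        by (auto simp: strip_upto_eq strip_eq_offset)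
      then show "1 / real k \<le> c v"
        using \<phi>_ge by (simp add: c_def divide_right_mono)
    qed
    also have "\<dots> \<le> (\<Sum>v \<in> ?S2. c v * a v)"
    proof (rule sum_mono2[OF S2(1)])
      show "strip_upto \<beta> b k \<subseteq> ?S2"
        using b by (auto simp: strip_upto_eq strip_eq_offset)
    qed (use c_nonneg a in simp)
    also have "\<dots> = (\<Sum>v | c v \<noteq> 0. c v * a v)"
      by (rule sum.mono_neutral_right[OF S2(1) supp]) auto
    finally show ?thesis .
  qed
  moreover have "(\<Sum>v\<in>W. \<bar>c (v - u) - c v\<bar>) \<le> \<epsilon> * \<bar>of_int (fst u)\<bar> + L * \<bar>strip_offset \<beta> u\<bar>"
    if u: "u \<in> strip \<beta> b" and W: "finite W" for u W
  proof -
    \<comment> \<open>Contains the columns that enter or leave the window \<open>[0, k)\<close>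
      under the shift. There the change is at most \<open>2 / k\<close>; in columns that stay
      inside, only the variation of \<open>\<phi>\<close> counts.\<close>
    define A where "A = {min 0 (fst u)..<max 0 (fst u)} \<union> {int k + min 0 (fst u)..<int k + max 0 (fst u)}"
    have "card A \<le> nat \<bar>fst u\<bar> + nat \<bar>fst u\<bar>"
      unfolding A_def using card_Un_le[of "{min 0 (fst u)..<max 0 (fst u)}" "{int k + min 0 (fst u)..<int k + max 0 (fst u)}"]
      by (auto simp: min_def max_def)
    then have card_A: "real (card A) \<le> 2 * \<bar>of_int (fst u)\<bar>"
      by linarith
    have A: "finite A"
      unfolding A_def by simp
    let ?SA = "strip \<beta> (3 * b) \<inter> (A \<times> UNIV)"
    have SA: "finite ?SA" "real (card ?SA) \<le> (6 * b + 1) * (2 * \<bar>of_int (fst u)\<bar>)"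
    proof -
      show "finite ?SA"
        using strip_window(1)[OF A, of "3 * b" \<beta>] b by simp
      have "real (card ?SA) \<le> (6 * b + 1) * real (card A)"
        using strip_window(2)[OF A, of "3 * b" \<beta>] b by simp
      also have "\<dots> \<le> (6 * b + 1) * (2 * \<bar>of_int (fst u)\<bar>)"
        using card_A b by (intro mult_left_mono) auto
      finally show "real (card ?SA) \<le> (6 * b + 1) * (2 * \<bar>of_int (fst u)\<bar>)" .
    qed
    let ?d = "\<bar>strip_offset \<beta> u\<bar>"
    have "\<bar>c (v - u) - c v\<bar> \<le> (if v \<in> ?SA then 2 / real k else 0) + (if v \<in> ?S3 then ?d / b / real k else 0)" for v
    proof (cases "v \<in> strip \<beta> (3 * b)")
      case False
      then have far: "\<bar>strip_offset \<beta> v\<bar> > 3 * b"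
        by (simp add: strip_eq_offset)
      have "\<bar>strip_offset \<beta> (v - u)\<bar> > 2 * b"
        using far u unfolding strip_offset_diff strip_eq_offset by simp
      then have "c (v - u) = 0" "c v = 0"
        using far b by (simp_all add: c_def \<phi>_0)
      then show ?thesis
        using b by simp
    next
      case strip: True
      have c_le: "0 \<le> c w" "c w \<le> 2 / real k" for w
        using \<phi>_le c_nonneg by (simp_all add: c_def divide_right_mono)
      show ?thesis
      proof (cases "fst v - fst u \<in> {0..<int k} \<longleftrightarrow> fst v \<in> {0..<int k}")
        case False
        then have "fst v \<in> A"
          by (auto simp: A_def min_def max_def)
        then have "v \<in> ?SA"
          using strip by (cases v) auto
        then have "2 / real k \<le> (if v \<in> ?SA then 2 / real k else 0) + (if v \<in> ?S3 then ?d / b / real k else 0)"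
          using b by simp
        then show ?thesis
          using c_le[of v] c_le[of "v - u"] by linarith
      next
        case same: True
        show ?thesis
        proof (cases "fst v \<in> {0..<int k}")
          case True
          then have "\<bar>c (v - u) - c v\<bar> = \<bar>\<phi> (strip_offset \<beta> (v - u)) - \<phi> (strip_offset \<beta> v)\<bar> / real k"
            using same by (simp add: c_def abs_divide flip: diff_divide_distrib)
          also have "\<dots> \<le> (\<bar>strip_offset \<beta> (v - u) - strip_offset \<beta> v\<bar> / b) / real k"
            by (intro divide_right_mono \<phi>_lip) simp
          also have "\<dots> = ?d / b / real k"
            by (simp add: strip_offset_diff)
          finally have "\<bar>c (v - u) - c v\<bar> \<le> ?d / b / real k" .
          moreover have "v \<in> ?S3"
            using strip True by (cases v) auto
          then have "?d / b / real k \<le> (if v \<in> ?SA then 2 / real k else 0) + (if v \<in> ?S3 then ?d / b / real k else 0)"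
            by simp
          ultimately show ?thesis
            by (rule order_trans)
        next
          case False
          then have "c (v - u) = 0" "c v = 0"
            using same by (auto simp: c_def)
          then show ?thesis
            using b by simp
        qed
      qed
    qed
    then have "(\<Sum>v\<in>W. \<bar>c (v - u) - c v\<bar>)
        \<le> (\<Sum>v\<in>W. (if v \<in> ?SA then 2 / real k else 0) + (if v \<in> ?S3 then ?d / b / real k else 0))"
      by (rule sum_mono)
    also have "\<dots> = (\<Sum>v\<in>W. if v \<in> ?SA then 2 / real k else 0) + (\<Sum>v\<in>W. if v \<in> ?S3 then ?d / b / real k else 0)"
      by (rule sum.distrib)
    also have "\<dots> \<le> real (card ?SA) * (2 / real k) + real (card ?S3) * (?d / b / real k)"
      by (intro add_mono sum_if_mem_le W SA(1) S3(1)) (use b in auto)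
    also have "\<dots> \<le> (6 * b + 1) * (2 * \<bar>of_int (fst u)\<bar>) * (2 / real k) + (6 * b + 1) * real k * (?d / b / real k)"
      by (intro add_mono mult_right_mono SA(2) S3(2)) (use b in auto)
    also have "\<dots> = 4 * (6 * b + 1) / real k * \<bar>of_int (fst u)\<bar> + (6 * b + 1) / b * ?d"
      using k_pos by simp
    also have "\<dots> \<le> \<epsilon> * \<bar>of_int (fst u)\<bar> + L * ?d"
      using k_ge b by (intro add_mono mult_right_mono) (auto simp: L)
    finally show ?thesis .
  qed
  ultimately have "c \<in> almost_invariant_weights \<beta> b L \<delta> a \<epsilon>"
    unfolding almost_invariant_weights_def by blast
  then show ?thesis
    by blast
qed

context Z2_mpds
begin

lemma precompact_orbit_from_weights:
  assumes f: "f \<in> L2_fun M" and h: "h \<in> L2_fun M" and mean: "L2_inner M f (\<lambda>_. 1) = 0" and b: "b > 0"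
    and ne: "\<And>\<epsilon>. \<epsilon> > 0 \<Longrightarrow>
      almost_invariant_weights \<beta> b L \<delta> (\<lambda>v. (cmod (L2_inner M (koopman T v f) h))\<^sup>2) \<epsilon> \<noteq> {}"
  obtains e where "e \<in> L2_fun M" "precompact_orbit M T \<beta> e" "L2_inner M e (\<lambda>_. 1) = 0" "\<delta> \<le> Re (L2_inner M e h)"
proof -
  define C where "C n = almost_invariant_weights \<beta> b L \<delta> (\<lambda>v. (cmod (L2_inner M (koopman T v f) h))\<^sup>2) (1 / real (Suc n))" for n
  have fin: "finite {v. c v \<noteq> 0}" if "c \<in> C n" for c n
    using that unfolding C_def by (rule almost_invariant_weightsD)
  obtain c where c: "\<And>n. c n \<in> C n"
    and c_Cauchy: "\<And>r. r > 0 \<Longrightarrow> \<exists>N. \<forall>m\<ge>N. \<forall>n\<ge>N. orbit_form f (\<lambda>v. c m v - c n v) < r"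
  proof (rule minimizing_sequence_Cauchy[of C "orbit_form f" "L\<^sup>2 * (L2_norm M f) ^ 4"])
    show "C n \<noteq> {}" for n
      unfolding C_def by (rule ne) simp
    show "C n \<subseteq> C m" if "m \<le> n" for m n
      unfolding C_def using that by (intro almost_invariant_weights_mono) (simp add: frac_le)
    show "(\<lambda>v. (p v + q v) / 2) \<in> C n" if "p \<in> C n" "q \<in> C n" for p q n
      using that unfolding C_def by (rule almost_invariant_weights_midpoint)
    show "0 \<le> orbit_form f p" for p
      by (rule orbit_form_nonneg[OF f h])
    show "orbit_form f p \<le> L\<^sup>2 * (L2_norm M f) ^ 4" if "p \<in> C 0" for p
      using almost_invariant_weightsD(2)[OF that[unfolded C_def] fin[OF that]] by (rule orbit_form_le[OF f])
    show "orbit_form f (\<lambda>v. p v - q v) = 2 * orbit_form f p + 2 * orbit_form f q - 4 * orbit_form f (\<lambda>v. (p v + q v) / 2)"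
      if "p \<in> C 0" "q \<in> C 0" for p q
      using fin[OF that(1)] fin[OF that(2)] by (rule orbit_form_parallelogram)
  qed (rule that)
  note fin_c = fin[OF c]
  have op_diff: "orbit_op f (\<lambda>v. c m v - c n v) h' = (\<lambda>x. orbit_op f (c m) h' x - orbit_op f (c n) h' x)" for m n h'
    by (intro ext orbit_op_diff fin_c)
  have op: "orbit_op f d h' \<in> L2_fun M" for d h'
    by (rule orbit_op_L2_fun[OF f])
  \<comment> \<open>Uniformity over all vectors of norm \<open>||h||\<close> is the point: it
    applies to every \<open>U^u h\<close> with one index, independent of \<open>u\<close>.\<close>
  have op_Cauchy: "\<exists>N. \<forall>m\<ge>N. \<forall>n\<ge>N. \<forall>h'\<in>L2_fun M. L2_norm M h' = L2_norm M h \<longrightarrow>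
      L2_norm M (\<lambda>x. orbit_op f (c m) h' x - orbit_op f (c n) h' x) < r" if r: "r > 0" for r
  proof -
    define s where "s = L2_norm M h + 1"
    have s: "s > 0" "L2_norm M h \<le> s"
      using L2_norm_nonneg[of M h] by (simp_all add: s_def)
    obtain N where N: "\<forall>m\<ge>N. \<forall>n\<ge>N. orbit_form f (\<lambda>v. c m v - c n v) < (r / s)\<^sup>2"
      using c_Cauchy[of "(r / s)\<^sup>2"] r s by auto
    have "L2_norm M (\<lambda>x. orbit_op f (c m) h' x - orbit_op f (c n) h' x) < r"
      if mn: "m \<ge> N" "n \<ge> N" and h': "h' \<in> L2_fun M" "L2_norm M h' = L2_norm M h" for m n h'
    proof -
      have "(L2_norm M (orbit_op f (\<lambda>v. c m v - c n v) h'))\<^sup>2 \<le> orbit_form f (\<lambda>v. c m v - c n v) * (L2_norm M h)\<^sup>2"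
        using L2_norm_orbit_op_le_form[OF f h'(1), of "\<lambda>v. c m v - c n v"] h'(2) by simp
      also have "\<dots> \<le> orbit_form f (\<lambda>v. c m v - c n v) * s\<^sup>2"
        using s L2_norm_nonneg[of M h] by (intro mult_left_mono power_mono orbit_form_nonneg[OF f h]) auto
      also have "\<dots> < (r / s)\<^sup>2 * s\<^sup>2"
        using N mn s by (intro mult_strict_right_mono) auto
      also have "\<dots> = r\<^sup>2"
        using s by (simp add: power_divide)
      finally show ?thesis
        unfolding op_diff by (rule power2_less_imp_less) (use r in simp)
    qed
    then show ?thesis
      by blast
  qed
  obtain e where e: "e \<in> L2_fun M" "(\<lambda>n. L2_norm M (\<lambda>x. orbit_op f (c n) h x - e x)) \<longlonglongrightarrow> 0"
  proof (rule L2_complete[of "\<lambda>n. orbit_op f (c n) h"])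
    show "\<exists>N. \<forall>m\<ge>N. \<forall>n\<ge>N. L2_norm M (\<lambda>x. orbit_op f (c m) h x - orbit_op f (c n) h x) < r" if "r > 0" for r
      using op_Cauchy[OF that] h by blast
  qed (rule op, rule that)
  have inner_lim: "(\<lambda>n. L2_inner M (orbit_op f (c n) h) g) \<longlonglongrightarrow> L2_inner M e g" if g: "g \<in> L2_fun M" for g
  proof -
    have "(\<lambda>n. L2_norm M (\<lambda>x. orbit_op f (c n) h x - e x) * L2_norm M g) \<longlonglongrightarrow> 0 * L2_norm M g"
      by (intro tendsto_intros e)
    then have lim: "(\<lambda>n. L2_norm M (\<lambda>x. orbit_op f (c n) h x - e x) * L2_norm M g) \<longlonglongrightarrow> 0"
      by simp
    have "(\<lambda>n. L2_inner M (orbit_op f (c n) h) g - L2_inner M e g) \<longlonglongrightarrow> 0"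
    proof (rule Lim_null_comparison[OF always_eventually lim], rule allI)
      show "norm (L2_inner M (orbit_op f (c n) h) g - L2_inner M e g)
          \<le> L2_norm M (\<lambda>x. orbit_op f (c n) h x - e x) * L2_norm M g" for n
        unfolding L2_inner_diff_left[OF op e(1) g, symmetric]
        by (rule L2_Cauchy_Schwarz[OF L2_fun_diff[OF op e(1)] g])
    qed
    then show ?thesis
      by (rule Lim_null[THEN iffD2])
  qed
  have "L2_inner M e (\<lambda>_. 1) = 0"
    using inner_lim[OF L2_fun_const[of 1]] unfolding L2_inner_orbit_op_one[OF f mean]
    by (rule LIMSEQ_unique) (rule tendsto_const)
  moreover have "\<delta> \<le> Re (L2_inner M e h)"
  proof (rule LIMSEQ_le_const[OF tendsto_Re[OF inner_lim[OF h]]], intro exI allI impI)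
    show "\<delta> \<le> Re (L2_inner M (orbit_op f (c n) h) h)" for n
      using almost_invariant_weightsD(3)[OF c[of n, unfolded C_def]]
      unfolding L2_inner_orbit_op[OF f h] Re_complex_of_real .
  qed
  moreover have "precompact_orbit M T \<beta> e"
    unfolding precompact_orbit_def
  proof (intro allI impI)
    fix b' r :: real assume "b' > 0" and r: "r > 0"
    define K where "K = (L2_norm M f)\<^sup>2 * L2_norm M h"
    have K: "K \<ge> 0"
      by (simp add: K_def L2_norm_nonneg)
    \<comment> \<open>The strip is made so thin that the transversal cost
      \<open>L * \<eta> * K\<close> is at most \<open>r / 4\<close>, and no wider than
      \<open>b\<close>, where almost invariance is available.\<close>
    define \<eta> where "\<eta> = min b (r / (4 * (\<bar>L\<bar> * K + 1)))"
    have \<eta>: "\<eta> > 0" "\<eta> \<le> b"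
      using b r K by (auto simp: \<eta>_def intro!: divide_pos_pos add_nonneg_pos)
    have \<eta>_small: "\<bar>L\<bar> * \<eta> * K \<le> r / 4"
    proof -
      have "\<bar>L\<bar> * \<eta> * K \<le> \<bar>L\<bar> * (r / (4 * (\<bar>L\<bar> * K + 1))) * K"
        using K by (intro mult_right_mono mult_left_mono) (auto simp: \<eta>_def)
      also have "\<dots> = (\<bar>L\<bar> * K) / (\<bar>L\<bar> * K + 1) * (r / 4)"
        by (simp add: mult_ac)
      also have "\<dots> \<le> 1 * (r / 4)"
        using K r by (intro mult_right_mono) (auto simp: divide_le_eq_1 add_nonneg_pos)
      finally show ?thesis
        by simp
    qed
    obtain J where J: "\<And>n h'. n \<ge> J \<Longrightarrow> h' \<in> L2_fun M \<Longrightarrow> L2_norm M h' = L2_norm M h \<Longrightarrow>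
        L2_norm M (\<lambda>x. orbit_op f (c n) h' x - orbit_op f (c J) h' x) < r / 4"
      using op_Cauchy[of "r / 4"] r by fastforce
    have near: "L2_norm M (\<lambda>x. koopman T u e x - orbit_op f (c J) (koopman T u h) x) \<le> r / 2"
      if u: "u \<in> strip \<beta> \<eta>" for u
    proof -
      let ?h = "koopman T u h"
      have h': "?h \<in> L2_fun M" "L2_norm M ?h = L2_norm M h"
        by (rule koopman_L2_fun[OF h], rule L2_norm_koopman[OF h])
      have u_b: "u \<in> strip \<beta> b" and offset: "\<bar>strip_offset \<beta> u\<bar> \<le> \<eta>"
        using u \<eta>(2) by (auto simp: strip_eq_offset)
      \<comment> \<open>An auxiliary index \<open>n\<close> links \<open>U^u e\<close> to
        \<open>A_(c J) (U^u h)\<close> through the shifted weights and then \<open>c n\<close>. The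
        errors are the distance of \<open>A_(c n) h\<close> from \<open>e\<close>, the cost of the
        shift, and the Cauchy bound \<open>r / 4\<close>. For fixed \<open>u\<close>, letting
        \<open>n\<close> grow leaves \<open>r / 2\<close>.\<close>
      let ?err = "\<lambda>n. L2_norm M (\<lambda>x. orbit_op f (c n) h x - e x) + (1 / real (Suc n)) * (\<bar>of_int (fst u)\<bar> * K) + r / 2"
      have bound: "L2_norm M (\<lambda>x. koopman T u e x - orbit_op f (c J) ?h x) \<le> ?err n" if n: "n \<ge> J" for n
      proof -
        let ?c = "\<lambda>v. c n (v - u)"
        have "{v. ?c v \<noteq> 0} \<subseteq> (\<lambda>v. v + u) ` {v. c n v \<noteq> 0}"
        proof
          fix v assume "v \<in> {v. ?c v \<noteq> 0}"
          then show "v \<in> (\<lambda>v. v + u) ` {v. c n v \<noteq> 0}"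
            by (intro image_eqI[where x = "v - u"]) simp_all
        qed
        then have fin': "finite {v. ?c v \<noteq> 0}"
          by (rule finite_subset) (intro finite_imageI fin_c)
        have fin_diff: "finite {v. ?c v - c n v \<noteq> 0}"
          by (rule finite_subset[of _ "{v. ?c v \<noteq> 0} \<union> {v. c n v \<noteq> 0}"]) (use fin' fin_c in auto)
        have "L2_norm M (\<lambda>x. koopman T u e x - koopman T u (orbit_op f (c n) h) x)
            = L2_norm M (\<lambda>x. orbit_op f (c n) h x - e x)"
          unfolding L2_norm_koopman_diff[OF e(1) op] by (rule L2_norm_minus_commute)
        then have 1: "L2_norm M (\<lambda>x. koopman T u e x - orbit_op f ?c ?h x) = L2_norm M (\<lambda>x. orbit_op f (c n) h x - e x)"
          unfolding koopman_orbit_op[OF f h] .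
        have eq: "orbit_op f (\<lambda>v. ?c v - c n v) ?h = (\<lambda>x. orbit_op f ?c ?h x - orbit_op f (c n) ?h x)"
          by (intro ext orbit_op_diff fin' fin_c)
        have "L2_norm M (orbit_op f (\<lambda>v. ?c v - c n v) ?h) \<le> (\<Sum>v | ?c v - c n v \<noteq> 0. \<bar>?c v - c n v\<bar>) * K"
          using L2_norm_orbit_op_le_l1[OF f h'(1), of "\<lambda>v. ?c v - c n v"] unfolding h'(2) K_def .
        also have "\<dots> \<le> (1 / real (Suc n) * \<bar>of_int (fst u)\<bar> + L * \<bar>strip_offset \<beta> u\<bar>) * K"
          by (intro mult_right_mono K almost_invariant_weightsD(4)[OF c[of n, unfolded C_def] u_b fin_diff])
        also have "\<dots> \<le> (1 / real (Suc n) * \<bar>of_int (fst u)\<bar> + \<bar>L\<bar> * \<eta>) * K"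
          using offset by (intro mult_right_mono K add_left_mono mult_mono) auto
        also have "\<dots> \<le> (1 / real (Suc n)) * (\<bar>of_int (fst u)\<bar> * K) + r / 4"
          using \<eta>_small by (simp add: algebra_simps)
        finally have 2: "L2_norm M (\<lambda>x. orbit_op f ?c ?h x - orbit_op f (c n) ?h x)
            \<le> (1 / real (Suc n)) * (\<bar>of_int (fst u)\<bar> * K) + r / 4"
          unfolding eq .
        have "L2_norm M (\<lambda>x. koopman T u e x - orbit_op f (c J) ?h x)
            \<le> L2_norm M (\<lambda>x. koopman T u e x - orbit_op f ?c ?h x)
              + L2_norm M (\<lambda>x. orbit_op f ?c ?h x - orbit_op f (c J) ?h x)"
          by (intro L2_norm_triangle_diff koopman_L2_fun e op)
        moreover have "L2_norm M (\<lambda>x. orbit_op f ?c ?h x - orbit_op f (c J) ?h x)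
            \<le> L2_norm M (\<lambda>x. orbit_op f ?c ?h x - orbit_op f (c n) ?h x)
              + L2_norm M (\<lambda>x. orbit_op f (c n) ?h x - orbit_op f (c J) ?h x)"
          by (intro L2_norm_triangle_diff op)
        ultimately show ?thesis
          using 1 2 J[OF n h'] by linarith
      qed
      have "(\<lambda>n. 1 / real (Suc n)) \<longlonglongrightarrow> 0"
        using LIMSEQ_inverse_real_of_nat by (simp add: inverse_eq_divide)
      then have "?err \<longlonglongrightarrow> 0 + 0 * (\<bar>of_int (fst u)\<bar> * K) + r / 2"
        by (intro tendsto_intros e)
      then show ?thesis
        using bound by (intro LIMSEQ_le_const[of ?err "r / 2"]) auto
    qed
    \<comment> \<open>Bounds the coefficients of \<open>A_(c J) (U^u h)\<close> for all
      \<open>u\<close> at once, so one finite net serves the whole thin strip.\<close>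
    define R where "R = L * (L2_norm M h * L2_norm M f)"
    obtain N where N: "finite N" "N \<subseteq> L2_fun M"
      "\<forall>z. (\<forall>v \<in> {v. c J v \<noteq> 0}. cmod (z v) \<le> R) \<longrightarrow>
         (\<exists>g\<in>N. L2_norm M (\<lambda>x. (\<Sum>v | c J v \<noteq> 0. z v * koopman T v f x) - g x) < r / 2)"
      by (rule finite_net_of_lincombs[where g = "\<lambda>v. koopman T v f" and R = R,
            OF fin_c[of J] koopman_L2_fun[OF f] half_gt_zero[OF r]])
    have near_N: "\<exists>g\<in>N. L2_norm M (\<lambda>x. koopman T u e x - g x) < r" if u: "u \<in> strip \<beta> \<eta>" for u
    proof -
      have "cmod (of_real (c J v) * L2_inner M (koopman T u h) (koopman T v f)) \<le> R" for v
      proof -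
        have "cmod (L2_inner M (koopman T u h) (koopman T v f)) \<le> L2_norm M h * L2_norm M f"
          using L2_Cauchy_Schwarz[OF koopman_L2_fun[OF h, of u] koopman_L2_fun[OF f, of v]]
          by (simp only: L2_norm_koopman[OF f] L2_norm_koopman[OF h])
        moreover have "\<bar>c J v\<bar> \<le> L"
          using almost_invariant_weightsD(2)[OF c[of J, unfolded C_def], of "{v}"] by simp
        ultimately show ?thesis
          unfolding R_def norm_mult norm_of_real by (intro mult_mono) (auto intro: order_trans[OF abs_ge_zero])
      qed
      then have "\<exists>g\<in>N. L2_norm M (\<lambda>x. orbit_op f (c J) (koopman T u h) x - g x) < r / 2"
        unfolding orbit_op_def by (intro N(3)[rule_format])
      then obtain g where g: "g \<in> N" "L2_norm M (\<lambda>x. orbit_op f (c J) (koopman T u h) x - g x) < r / 2" ..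
      have "L2_norm M (\<lambda>x. koopman T u e x - g x) < r"
        using L2_norm_triangle_diff[OF koopman_L2_fun[OF e(1), of u] op[of "c J" "koopman T u h"], of g]
          near[OF u] g N(2) by auto
      with g(1) show ?thesis
        by blast
    qed
    obtain F where F: "finite F" "\<And>v. v \<in> strip \<beta> b' \<Longrightarrow> \<exists>w\<in>F. v - w \<in> strip \<beta> \<eta>"
      using strip_cover[OF \<eta>(1)] by blast
    \<comment> \<open>The wide strip is covered by translates of the thin one; as
      \<open>U^v e = U^w (U^(v-w) e)\<close>, the translated nets cover the orbit.\<close>
    define N' where "N' = (\<lambda>(w, g). koopman T w g) ` (F \<times> N)"
    have "\<exists>g\<in>N'. L2_norm M (\<lambda>x. koopman T v e x - g x) < r" if v: "v \<in> strip \<beta> b'" for v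
    proof -
      obtain w where w: "w \<in> F" "v - w \<in> strip \<beta> \<eta>"
        using F(2)[OF v] by blast
      obtain g where g: "g \<in> N" "L2_norm M (\<lambda>x. koopman T (v - w) e x - g x) < r"
        using near_N[OF w(2)] by blast
      have "koopman T v e = koopman T w (koopman T (v - w) e)"
        using koopman_add[of "v - w" w e] by simp
      moreover have "g \<in> L2_fun M"
        using g(1) N(2) by blast
      ultimately have "L2_norm M (\<lambda>x. koopman T v e x - koopman T w g x) < r"
        using g(2) by (simp only: L2_norm_koopman_diff[OF koopman_L2_fun[OF e(1)]])
      moreover have "koopman T w g \<in> N'"
        unfolding N'_def using w(1) g(1) by force
      ultimately show ?thesis
        by blast
    qed
    moreover have "finite N'"
      unfolding N'_def using F(1) N(1) by simp
    moreover have "N' \<subseteq> L2_fun M"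
      unfolding N'_def using N(2) koopman_L2_fun by auto
    ultimately show "\<exists>N. finite N \<and> N \<subseteq> L2_fun M \<and>
        (\<forall>v \<in> strip \<beta> b'. \<exists>g\<in>N. L2_norm M (\<lambda>x. koopman T v e x - g x) < r)"
      by (intro exI[of _ N']) simp
  qed
  ultimately show ?thesis
    using e(1) that by simp
qed

end

section \<open>Weak mixing implies decay of correlations\<close>

context Z2_mpds
begin

lemma weakly_mixing_imp_correlation_decay:
  assumes wm: "directional_weakly_mixing M T \<beta>" and b: "b > 0"
    and f: "f \<in> L2_fun M" and g: "g \<in> L2_fun M"
  shows "(\<lambda>k. (\<Sum>v \<in> strip_upto \<beta> b k.
              cmod (L2_inner M (koopman T v f) g - L2_inner M f (\<lambda>_. 1) * L2_inner M (\<lambda>_. 1) g))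
           / real (card (strip_upto \<beta> b k))) \<longlonglongrightarrow> 0"
proof (rule ccontr)
  define m where "m = L2_inner M f (\<lambda>_. 1)"
  \<comment> \<open>Subtracting the mean absorbs the product term: the centred correlations of
    \<open>f\<close> with \<open>g\<close> are the plain correlations of \<open>f0\<close> with
    \<open>g\<close>.\<close>
  define f0 where "f0 = (\<lambda>x. f x - m * 1)"
  have one: "(\<lambda>_. 1) \<in> L2_fun M" and m1: "(\<lambda>_. m * 1) \<in> L2_fun M"
    by (rule L2_fun_const)+
  have f0: "f0 \<in> L2_fun M"
    unfolding f0_def by (rule L2_fun_diff[OF f m1])
  have mean: "L2_inner M f0 (\<lambda>_. 1) = 0"
    unfolding f0_def L2_inner_diff_left[OF f m1 one] L2_inner_cmult_left
    by (simp add: m_def L2_inner_def[of M "\<lambda>_. 1" "\<lambda>_. 1"] prob_space)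
  have corr: "L2_inner M (koopman T v f) g - m * L2_inner M (\<lambda>_. 1) g = L2_inner M (koopman T v f0) g" for v
  proof -
    have "koopman T v f0 = (\<lambda>x. koopman T v f x - m * 1)"
      by (simp add: koopman_def f0_def comp_def)
    then show ?thesis
      by (simp only: L2_inner_diff_left[OF koopman_L2_fun[OF f] m1 g] L2_inner_cmult_left)
  qed
  let ?a = "\<lambda>v. cmod (L2_inner M (koopman T v f0) g)"
  let ?N = "\<lambda>k. real (card (strip_upto \<beta> b k))"
  let ?S = "\<lambda>k. \<Sum>v \<in> strip_upto \<beta> b k. ?a v"
  assume "\<not> ?thesis"
  then have not_lim: "\<not> (\<lambda>k. ?S k / ?N k) \<longlonglongrightarrow> 0"
    unfolding m_def[symmetric] corr .
  have abs_avg: "\<bar>?S k / ?N k\<bar> = ?S k / ?N k" for k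
    by (intro abs_of_nonneg divide_nonneg_nonneg sum_nonneg) auto
  have "\<not> (\<forall>r>0. \<exists>K. \<forall>k\<ge>K. ?S k / ?N k < r)"
    using not_lim by (simp only: LIMSEQ_iff diff_0_right real_norm_def abs_avg) simp
  then obtain r where r: "r > 0" "\<forall>K. \<exists>k\<ge>K. r \<le> ?S k / ?N k"
    by (meson not_less)
  obtain D E where D: "D > 0" "\<And>k. real k \<le> D * (?N k + E)"
    using card_strip_upto_ge[OF b] by blast
  \<comment> \<open>Cauchy-Schwarz turns an average of at least \<open>r\<close> into a mean square
    of at least \<open>r^2\<close>. The factor \<open>1 / (2 * D)\<close> comes from
    \<open>?N k >= k / (2 * D)\<close>, valid once \<open>k\<close> exceeds
    \<open>2 * D * E\<close>.\<close>
  define \<delta> where "\<delta> = r\<^sup>2 / (2 * D)"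
  have \<delta>: "\<delta> > 0"
    using r(1) D(1) by (simp add: \<delta>_def)
  have freq: "\<exists>k\<ge>K. \<delta> * real k \<le> (\<Sum>v \<in> strip_upto \<beta> b k. (?a v)\<^sup>2)" for K
  proof -
    obtain k where k: "max K (nat \<lceil>2 * D * E\<rceil> + 1) \<le> k" "r \<le> ?S k / ?N k"
      using r(2) by blast
    have k_ge: "2 * D * E \<le> real k" "K \<le> k"
      using k(1) by linarith+
    have "real k \<le> 2 * D * ?N k"
      using D(2)[of k] k_ge(1) by (simp add: algebra_simps)
    then have N_ge: "real k / (2 * D) \<le> ?N k"
      using D(1) by (simp add: field_simps)
    moreover have "0 < real k / (2 * D)"
      using k(1) D(1) by simp
    ultimately have N_pos: "?N k > 0"
      by linarith
    then have "r * ?N k \<le> ?S k"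
      using k(2) by (simp add: field_simps)
    then have "(r * ?N k)\<^sup>2 \<le> (?S k)\<^sup>2"
      using r(1) by (intro power_mono) auto
    also have "\<dots> \<le> (\<Sum>v \<in> strip_upto \<beta> b k. (?a v)\<^sup>2) * ?N k"
      using Cauchy_Schwarz_ineq_sum[of ?a "\<lambda>_. 1" "strip_upto \<beta> b k"] by simp
    finally have "?N k * (r\<^sup>2 * ?N k) \<le> ?N k * (\<Sum>v \<in> strip_upto \<beta> b k. (?a v)\<^sup>2)"
      by (simp add: power2_eq_square mult_ac)
    then have "r\<^sup>2 * ?N k \<le> (\<Sum>v \<in> strip_upto \<beta> b k. (?a v)\<^sup>2)"
      using N_pos by (rule mult_left_le_imp_le)
    moreover have "\<delta> * real k \<le> r\<^sup>2 * ?N k"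
      using mult_left_mono[OF N_ge, of "r\<^sup>2"] by (simp add: \<delta>_def)
    ultimately show ?thesis
      using k_ge(2) by (intro exI[of _ k]) simp
  qed
  obtain e where e: "e \<in> L2_fun M" "precompact_orbit M T \<beta> e" "L2_inner M e (\<lambda>_. 1) = 0"
      "\<delta> \<le> Re (L2_inner M e g)"
  proof (rule precompact_orbit_from_weights[OF f0 g mean b])
    show "almost_invariant_weights \<beta> b (2 * (4 * b + 1) + (6 * b + 1) / b) \<delta> (\<lambda>v. (?a v)\<^sup>2) \<epsilon> \<noteq> {}"
      if "\<epsilon> > 0" for \<epsilon>
      using that by (intro almost_invariant_weights_exist[OF b _ freq refl]) auto
  qed (rule that)
  have "AE x in M. e x = 0"
    using weakly_mixing_precompact_imp_AE_0[OF wm e(1,2)] e(3) by (simp add: L2_inner_def)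
  then have "L2_norm M e = 0"
    using L2_norm_eq_0_iff[OF e(1)] by simp
  then have "L2_inner M e g = 0"
    using L2_Cauchy_Schwarz[OF e(1) g] by simp
  with e(4) \<delta> show False
    by simp
qed

end

theorem theorem1p1:
  fixes M :: "'a::metric_space measure"
    and T :: "int \<times> int \<Rightarrow> 'a \<Rightarrow> 'a"
    and \<beta> b :: real
  assumes "Z2_mpds M T"
    and "\<beta> \<notin> \<rat>"
    and "b > 0"
  shows "(directional_weakly_mixing M T \<beta> \<longleftrightarrow>
      (\<forall>f \<in> L2_fun M.
        (\<lambda>k. (\<Sum>v \<in> strip_upto \<beta> b k.
                cmod (L2_inner M (koopman T v f) f
                      - L2_inner M f (\<lambda>_. 1) * L2_inner M (\<lambda>_. 1) f))
             / real (card (strip_upto \<beta> b k))) \<longlonglongrightarrow> 0))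
    \<and> (directional_weakly_mixing M T \<beta> \<longleftrightarrow>
      (\<forall>f \<in> L2_fun M. \<forall>g \<in> L2_fun M.
        (\<lambda>k. (\<Sum>v \<in> strip_upto \<beta> b k.
                cmod (L2_inner M (koopman T v f) g
                      - L2_inner M f (\<lambda>_. 1) * L2_inner M (\<lambda>_. 1) g))
             / real (card (strip_upto \<beta> b k))) \<longlonglongrightarrow> 0))"
proof -
  interpret Z2_mpds M T
    by (rule assms(1))
  \<comment> \<open>The two implications needed are (a) to (c) and (b) to (a); the remaining ones
    follow by taking \<open>g = f\<close>.\<close>
  note ac = weakly_mixing_imp_correlation_decay[OF _ \<open>b > 0\<close>]
  note ba = autocorrelation_decay_imp_weakly_mixing[OF \<open>b > 0\<close>]
  show ?thesis
    by (intro conjI iffI ballI) (rule ac ba; blast)+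
qed

end
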